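(* Let $\theta$ be an inner function, let $\theta_0$ be its $0$-th Fourier coefficient, and let $\phi\in L^\infty$. Then the dual truncated Hankel operator $\mathcal{H}_\phi^\theta$ satisfies $$\mathcal{H}_\phi^\theta-U_\theta^*\mathcal{H}_\phi^\theta U_\theta^*=\bar z\otimes\left(\beta_\phi-\langle\beta_\phi,\theta\rangle\theta\right)+\left(Q_\theta J\eta_\phi+\delta\bar z\right)\otimes\theta,$$ where $\beta_\phi=Q_\theta\left(\bar\phi z(1-\bar\theta_0\breve\theta)\right)$, $\eta_\phi=\phi(\theta-\theta_0)$ and $\delta=\theta_0\left\{(J(\phi\bar z))_0-\theta_0(\bar\theta J(\phi\bar z))_0\right\}$.
   Context: $\mathbb{T}$ is the unit circle with normalized Lebesgue measure, $L^2=L^2(\mathbb{T})$ with inner product $\langle\cdot,\cdot\rangle$ linear in the first entry, $L^\infty=L^\infty(\mathbb{T})$. For $F\in L^2$, $(F)_k$ denotes its $k$-th Fourier coefficient. $H^2\subset L^2$ is the Hardy space (functions whose negative Fourier coefficients vanish), $H_0^2=zH^2$, $\overline{H_0^2}=L^2\ominus H^2$. $P:L^2\to H^2$ is the orthogonal projection and $Q=I-P$ is the orthogonal projection onto $\overline{H_0^2}$. The flip $J$ on $L^2$ is $(Jf)(z)=\breve f(z)=f(\bar z)$, $z\in\mathbb{T}$. For an inner function $\theta$ (bounded analytic on the disk, unimodular a.e. on $\mathbb{T}$), $K_\theta=H^2\ominus\theta H^2$ and $K_\theta^\perp=L^2\ominus K_\theta=\overline{H_0^2}\oplus\theta H^2$;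 $Q_\theta=Q+\theta P\bar\theta$ is the orthogonal projection of $L^2$ onto $K_\theta^\perp$. For $\phi\in L^\infty$ the dual truncated Hankel operator is $\mathcal{H}_\phi^\theta:K_\theta^\perp\to K_\theta^\perp$, $\mathcal{H}_\phi^\theta(h)=Q_\theta J(\phi h)$. The compressed shift on $K_\theta^\perp$ is $U_\theta h=Q_\theta(zh)$. For $f,g$ in a Hilbert space, $f\otimes g$ is the operator $h\mapsto\langle h,g\rangle f$. *)

theory Defs
  imports "HOL-Analysis.Analysis"
begin

definition circle :: "complex measure" where
  "circle = distr (uniform_measure lborel {- pi..pi}) (restrict_space borel (sphere 0 1)) cis"

definition square_integrable :: "(complex \<Rightarrow> complex) \<Rightarrow> bool" where
  "square_integrable f \<longleftrightarrow>
     f \<in> borel_measurable circle \<and> integrable circle (\<lambda>z. (cmod (f z))\<^sup>2)"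

lemma sets_circle [measurable_cong]: "sets circle = sets (restrict_space borel (sphere 0 1))"
  by (simp add: circle_def)

lemma space_circle: "space circle = sphere 0 1"
  by (simp add: circle_def space_restrict_space)

lemma borel_measurable_circle:
  "f \<in> borel_measurable borel \<Longrightarrow> f \<in> borel_measurable circle"
  using measurable_cong_sets[OF sets_circle refl] measurable_restrict_space1 by blast

lemma cis_measurable:
  "cis \<in> measurable (uniform_measure lborel {- pi..pi}) (restrict_space borel (sphere 0 1))"
proof (rule measurable_restrict_space2)
  have "cis \<in> borel_measurable borel"
    by (intro borel_measurable_continuous_onI continuous_intros)
  then show "cis \<in> borel_measurable (uniform_measure lborel {- pi..pi})"
    by simp
qed auto

lemma finite_measure_circle: "finite_measure circle"
  unfolding circle_def
proof (rule finite_measure.finite_measure_distr[OF _ cis_measurable])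
  show "finite_measure (uniform_measure lborel {- pi..pi})"
    by (rule finite_measureI) (simp add: emeasure_uniform_measure)
qed

lemma cnj_measurable_circle: "cnj \<in> measurable circle circle"
proof -
  have "cnj \<in> measurable (restrict_space borel (sphere 0 1)) (restrict_space borel (sphere 0 1))"
    by (rule measurable_restrict_space3) (auto simp: borel_measurable_continuous_onI continuous_on_cnj)
  then show ?thesis
    using measurable_cong_sets[OF sets_circle sets_circle] by blast
qed

lemma distr_uminus_uniform:
  "distr (uniform_measure lborel {- pi..pi}) (uniform_measure lborel {- pi..pi}) uminus
    = uniform_measure lborel {- pi..pi :: real}" (is "distr ?M ?M uminus = ?M")
proof (rule measure_eqI)
  fix A assume "A \<in> sets (distr ?M ?M uminus)"
  then have A [measurable]: "A \<in> sets borel" by simp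
  have m: "(uminus :: real \<Rightarrow> real) \<in> measurable ?M ?M" 
    by simp
  have v: "uminus -` B \<in> sets lborel" if "B \<in> sets lborel" for B :: "real set"
    using measurable_sets[of "uminus :: real \<Rightarrow> real" borel borel B] that by simp
  have "emeasure (distr ?M ?M uminus) A = emeasure ?M (uminus -` A)"
    using A m by (subst emeasure_distr) auto
  also have "\<dots> = emeasure lborel ({- pi..pi} \<inter> uminus -` A) / emeasure lborel {- pi..pi}"
    using v A by (subst emeasure_uniform_measure) auto
  also have "{- pi..pi} \<inter> uminus -` A = uminus -` ({- pi..pi} \<inter> A)" by auto
  also have "emeasure lborel (uminus -` ({- pi..pi} \<inter> A)) =
             emeasure (distr lborel borel uminus) ({- pi..pi} \<inter> A)"
    by (subst emeasure_distr) auto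
  also have "distr lborel borel uminus = (lborel :: real measure)"
    by (rule lborel_distr_uminus)
  also have "emeasure lborel ({- pi..pi} \<inter> A) / emeasure lborel {- pi..pi} = emeasure ?M A"
    using A by (subst emeasure_uniform_measure) auto
  finally show "emeasure (distr ?M ?M uminus) A = emeasure ?M A" .
qed simp

lemma distr_cnj_circle: "distr circle circle cnj = circle"
proof -
  let ?M = "uniform_measure lborel {- pi..pi :: real}"
  let ?T = "restrict_space borel (sphere 0 1) :: complex measure"
  have c: "cnj \<in> measurable ?T ?T"
    using cnj_measurable_circle measurable_cong_sets[OF sets_circle sets_circle] by blast
  have m: "(uminus :: real \<Rightarrow> real) \<in> measurable ?M ?M" by simp
  have "distr circle circle cnj = distr circle ?T cnj"
    by (rule distr_cong) (simp_all add: sets_circle)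
  also have "\<dots> = distr ?M ?T (cnj \<circ> cis)"
    unfolding circle_def by (rule distr_distr[OF c cis_measurable])
  also have "cnj \<circ> cis = cis \<circ> uminus" by (auto simp: cis_cnj)
  also have "distr ?M ?T (cis \<circ> uminus) = distr (distr ?M ?M uminus) ?T cis"
    by (rule distr_distr[OF cis_measurable m, symmetric])
  also have "\<dots> = circle" by (simp only: distr_uminus_uniform circle_def)
  finally show ?thesis .
qed

lemma AE_circle_cnj: "AE z in circle. P z \<Longrightarrow> AE z in circle. P (cnj z)"
  by (metis AE_distrD cnj_measurable_circle distr_cnj_circle)

lemma square_integrable_add:
  assumes "square_integrable f" "square_integrable g"
  shows "square_integrable (\<lambda>z. f z + g z)"
proof -
  have m: "f \<in> borel_measurable circle" "g \<in> borel_measurable circle"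
    using assms by (auto simp: square_integrable_def)
  have b: "(cmod (f z + g z))\<^sup>2 \<le> 2 * (cmod (f z))\<^sup>2 + 2 * (cmod (g z))\<^sup>2" for z
  proof -
    have "(cmod (f z + g z))\<^sup>2 \<le> (cmod (f z) + cmod (g z))\<^sup>2"
      by (intro power_mono norm_triangle_ineq) auto
    also have "\<dots> \<le> 2 * (cmod (f z))\<^sup>2 + 2 * (cmod (g z))\<^sup>2"
      using zero_le_power2[of "cmod (f z) - cmod (g z)"] by (simp add: power2_eq_square algebra_simps)
    finally show ?thesis .
  qed
  have "integrable circle (\<lambda>z. 2 * (cmod (f z))\<^sup>2 + 2 * (cmod (g z))\<^sup>2)"
    using assms by (auto simp: square_integrable_def)
  then have "integrable circle (\<lambda>z. (cmod (f z + g z))\<^sup>2)"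
    by (rule Bochner_Integration.integrable_bound) (use m b in auto)
  then show ?thesis using m by (simp add: square_integrable_def)
qed

lemma square_integrable_scale:
  "square_integrable f \<Longrightarrow> square_integrable (\<lambda>z. c * f z)"
  by (auto simp: square_integrable_def norm_mult power_mult_distrib)

lemma square_integrable_bounded:
  assumes "f \<in> borel_measurable circle" "\<And>z. z \<in> sphere 0 1 \<Longrightarrow> cmod (f z) \<le> C"
  shows "square_integrable f"
proof -
  interpret finite_measure circle by (rule finite_measure_circle)
  have "AE z in circle. norm ((cmod (f z))\<^sup>2) \<le> C\<^sup>2"
    using assms(2) by (intro AE_I2) (auto simp: space_circle intro!: power_mono)
  then have "integrable circle (\<lambda>z. (cmod (f z))\<^sup>2)"
    using assms(1) by (intro integrable_const_bound) auto
  then show ?thesis using assms(1) by (simp add: square_integrable_def)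
qed

lemma cnj_borel_measurable:
  "f \<in> borel_measurable M \<Longrightarrow> (\<lambda>z. cnj (f z)) \<in> borel_measurable M"
  by (rule borel_measurable_continuous_on[OF continuous_on_cnj]) (auto intro: continuous_on_id)

lemma square_integrable_cnj:
  "square_integrable f \<Longrightarrow> square_integrable (\<lambda>z. cnj (f z))"
  by (auto simp: square_integrable_def intro: cnj_borel_measurable)

lemma square_integrable_flip:
  assumes "square_integrable f"
  shows "square_integrable (\<lambda>z. f (cnj z))"
proof -
  have m: "f \<in> borel_measurable circle" and i: "integrable circle (\<lambda>z. (cmod (f z))\<^sup>2)"
    using assms by (auto simp: square_integrable_def)
  have "(\<lambda>z. f (cnj z)) \<in> borel_measurable circle"
    by (rule measurable_compose[OF cnj_measurable_circle m])
  moreover have "integrable circle (\<lambda>z. (cmod (f (cnj z)))\<^sup>2)"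
    by (rule integrable_distr[OF cnj_measurable_circle]) (simp add: distr_cnj_circle i)
  ultimately show ?thesis by (simp add: square_integrable_def)
qed

lemma square_integrable_cong_AE:
  assumes "f \<in> borel_measurable circle" "g \<in> borel_measurable circle" "AE z in circle. f z = g z"
  shows "square_integrable f \<longleftrightarrow> square_integrable g"
proof -
  have "integrable circle (\<lambda>z. (cmod (f z))\<^sup>2) \<longleftrightarrow> integrable circle (\<lambda>z. (cmod (g z))\<^sup>2)"
    using assms by (intro integrable_cong_AE) auto
  then show ?thesis using assms by (simp add: square_integrable_def)
qed

lemma AE_circle_cong:
  assumes "AE z in circle. f z = g z"
  shows "(AE z in circle. R z (f z)) \<longleftrightarrow> (AE z in circle. R z (g z))"
  by (rule eventually_cong[OF assms]) simp

quotient_type L2 = "complex \<Rightarrow> complex" / partial: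
  "\<lambda>f g. square_integrable f \<and> square_integrable g \<and> (AE z in circle. f z = g z)"
proof (rule part_equivpI)
  show "\<exists>f. square_integrable f \<and> square_integrable f \<and> (AE z in circle. f z = f z)"
    by (rule exI[of _ "\<lambda>_. 0"]) (simp add: square_integrable_def)
qed (auto simp: symp_def transp_def)

text \<open>
  The pointwise product of two square-integrable functions need not be square-integrable;
  \<open>f * g\<close> is the class of the product when it is, and is 0 otherwise. It is the genuine
  product as soon as one of the factors is essentially bounded.
\<close>

instantiation L2 :: "{ab_group_add, one, times}"
begin

lift_definition zero_L2 :: L2 is "\<lambda>_. 0"
  by (simp add: square_integrable_def)

lift_definition one_L2 :: L2 is "\<lambda>_. 1"
  by (auto intro: square_integrable_bounded[where C = 1])

lift_definition plus_L2 :: "L2 \<Rightarrow> L2 \<Rightarrow> L2" is "\<lambda>f g z. f z + g z"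
  by (auto intro: square_integrable_add)

lift_definition uminus_L2 :: "L2 \<Rightarrow> L2" is "\<lambda>f z. - f z"
  by (auto simp: square_integrable_def)

lift_definition minus_L2 :: "L2 \<Rightarrow> L2 \<Rightarrow> L2" is "\<lambda>f g z. f z - g z"
proof -
  fix f f' g g'
  assume f: "square_integrable f \<and> square_integrable f' \<and> (AE z in circle. f z = f' z)"
    and g: "square_integrable g \<and> square_integrable g' \<and> (AE z in circle. g z = g' z)"
  have *: "square_integrable (\<lambda>z. u z - v z)"
    if "square_integrable u" "square_integrable v" for u v
    using square_integrable_add[OF that(1) square_integrable_scale[OF that(2), of "-1"]] by simp
  show "square_integrable (\<lambda>z. f z - g z) \<and> square_integrable (\<lambda>z. f' z - g' z) \<and>
        (AE z in circle. f z - g z = f' z - g' z)"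
    using f g by (auto intro: *)
qed

lift_definition times_L2 :: "L2 \<Rightarrow> L2 \<Rightarrow> L2" is
  "\<lambda>f g. if square_integrable (\<lambda>z. f z * g z) then (\<lambda>z. f z * g z) else (\<lambda>_. 0)"
proof -
  fix f f' g g'
  assume f: "square_integrable f \<and> square_integrable f' \<and> (AE z in circle. f z = f' z)"
    and g: "square_integrable g \<and> square_integrable g' \<and> (AE z in circle. g z = g' z)"
  have ae: "AE z in circle. f z * g z = f' z * g' z"
    using f g by auto
  have "square_integrable (\<lambda>z. f z * g z) \<longleftrightarrow> square_integrable (\<lambda>z. f' z * g' z)"
    using f g ae by (intro square_integrable_cong_AE) (auto simp: square_integrable_def)
  moreover have "square_integrable (\<lambda>_. 0)"
    by (simp add: square_integrable_def)
  ultimately show "?thesis f f' g g'" using ae by simp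
qed

instance
proof
  fix a b c :: L2
  show "a + b + c = a + (b + c)"
    by transfer (simp add: square_integrable_add add.assoc)
  show "a + b = b + a"
    by transfer (simp add: square_integrable_add add.commute)
  show "0 + a = a"
    by transfer simp
  show "- a + a = 0"
    by transfer (simp add: square_integrable_def)
  have "square_integrable (\<lambda>z. f z - g z)" if "square_integrable f" "square_integrable g" for f g
    using square_integrable_add[OF that(1) square_integrable_scale[OF that(2), of "-1"]] by simp
  then show "a - b = a + - b"
    by transfer simp
qed

end

lift_definition scaleC :: "complex \<Rightarrow> L2 \<Rightarrow> L2"  (infixr \<open>*\<^sub>C\<close> 75) is "\<lambda>c f z. c * f z"
  by (auto intro: square_integrable_scale)

lift_definition conj_L2 :: "L2 \<Rightarrow> L2" is "\<lambda>f z. cnj (f z)"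
  by (auto intro: square_integrable_cnj)

lift_definition flip :: "L2 \<Rightarrow> L2" is "\<lambda>f z. f (cnj z)"
proof -
  fix f g :: "complex \<Rightarrow> complex"
  assume "square_integrable f \<and> square_integrable g \<and> (AE z in circle. f z = g z)"
  then show "square_integrable (\<lambda>z. f (cnj z)) \<and> square_integrable (\<lambda>z. g (cnj z)) \<and>
      (AE z in circle. f (cnj z) = g (cnj z))"
    using AE_circle_cnj[of "\<lambda>z. f z = g z"] by (simp add: square_integrable_flip)
qed

lift_definition zvar :: L2 is "\<lambda>z. z"
  by (auto intro!: square_integrable_bounded[where C = 1] borel_measurable_circle)

lift_definition cinner :: "L2 \<Rightarrow> L2 \<Rightarrow> complex" is "\<lambda>f g. LINT z|circle. f z * cnj (g z)"
proof -
  fix f f' g g'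
  assume f: "square_integrable f \<and> square_integrable f' \<and> (AE z in circle. f z = f' z)"
    and g: "square_integrable g \<and> square_integrable g' \<and> (AE z in circle. g z = g' z)"
  have "AE z in circle. f z * cnj (g z) = f' z * cnj (g' z)"
    using f g by auto
  then show "(LINT z|circle. f z * cnj (g z)) = (LINT z|circle. f' z * cnj (g' z))"
    using f g by (intro integral_cong_AE) (auto simp: square_integrable_def intro!: borel_measurable_times cnj_borel_measurable)
qed

lift_definition fourier_coeff :: "L2 \<Rightarrow> int \<Rightarrow> complex" is
  "\<lambda>f k. LINT z|circle. f z * z powi (- k)"
proof -
  fix f f' :: "complex \<Rightarrow> complex"
  assume f: "square_integrable f \<and> square_integrable f' \<and> (AE z in circle. f z = f' z)"
  show "(\<lambda>k. LINT z|circle. f z * z powi (- k)) = (\<lambda>k. LINT z|circle. f' z * z powi (- k))"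
  proof
    fix k :: int
    have [measurable]: "(\<lambda>z::complex. z powi (- k)) \<in> borel_measurable circle"
      by (rule borel_measurable_circle) (auto simp: power_int_def)
    have "AE z in circle. f z * z powi (- k) = f' z * z powi (- k)"
      using f by auto
    then show "(LINT z|circle. f z * z powi (- k)) = (LINT z|circle. f' z * z powi (- k))"
      using f by (intro integral_cong_AE) (auto simp: square_integrable_def)
  qed
qed

text \<open>Membership in \<open>L\<^sup>\<infinity>\<close>, for an element of \<open>L\<^sup>2\<close>.\<close>

lift_definition essentially_bounded :: "L2 \<Rightarrow> bool" is
  "\<lambda>f. \<exists>C. AE z in circle. cmod (f z) \<le> C"
  by (intro ex_cong1 AE_circle_cong[where R = "\<lambda>z w. cmod w \<le> _"]) blast

text \<open>
  An inner function is identified with its boundary function on the circle: \<open>\<theta>\<close> is inner if it is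
  the radial limit almost everywhere of a bounded analytic function \<open>F\<close> on the disk, and is
  unimodular almost everywhere.
\<close>

lift_definition inner_function :: "L2 \<Rightarrow> bool" is
  "\<lambda>\<theta>. (\<exists>F. F holomorphic_on ball 0 1 \<and> bounded (F ` ball 0 1) \<and>
            (AE z in circle. ((\<lambda>r. F (complex_of_real r * z)) \<longlongrightarrow> \<theta> z) (at_left 1))) \<and>
        (AE z in circle. cmod (\<theta> z) = 1)"
proof -
  fix f g :: "complex \<Rightarrow> complex"
  assume "square_integrable f \<and> square_integrable g \<and> (AE z in circle. f z = g z)"
  then have fg: "AE z in circle. f z = g z" by blast
  show "?thesis f g"
    using AE_circle_cong[OF fg, of "\<lambda>z w. cmod w = 1"]
      AE_circle_cong[OF fg, of "\<lambda>z w. ((\<lambda>r. F (complex_of_real r * z)) \<longlongrightarrow> w) (at_left 1)" for F]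
    by blast
qed

definition ortho :: "L2 set \<Rightarrow> L2 set" where
  "ortho S = {f. \<forall>g\<in>S. cinner f g = 0}"

definition ortho_proj :: "L2 set \<Rightarrow> L2 \<Rightarrow> L2" where
  "ortho_proj S f = (THE g. g \<in> S \<and> f - g \<in> ortho S)"

text \<open>The Hilbert space adjoint of an operator \<open>A\<close> on the closed subspace \<open>S\<close>.\<close>

definition adjoint_on :: "L2 set \<Rightarrow> (L2 \<Rightarrow> L2) \<Rightarrow> L2 \<Rightarrow> L2" where
  "adjoint_on S A g = (THE k. k \<in> S \<and> (\<forall>f\<in>S. cinner (A f) g = cinner f k))"

definition rank_one :: "L2 \<Rightarrow> L2 \<Rightarrow> L2 \<Rightarrow> L2"  (infix \<open>\<otimes>\<^sub>L\<close> 70) where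
  "(f \<otimes>\<^sub>L g) h = cinner h g *\<^sub>C f"

definition H2 :: "L2 set" where
  "H2 = {f. \<forall>k<0. fourier_coeff f k = 0}"

definition hardy_proj :: "L2 \<Rightarrow> L2" where
  "hardy_proj = ortho_proj H2"

definition hardy_coproj :: "L2 \<Rightarrow> L2" where
  "hardy_coproj f = f - hardy_proj f"

definition model_space :: "L2 \<Rightarrow> L2 set" where
  "model_space \<theta> = H2 \<inter> ortho ((\<lambda>h. \<theta> * h) ` H2)"

definition model_space_perp :: "L2 \<Rightarrow> L2 set" where
  "model_space_perp \<theta> = ortho (model_space \<theta>)"

definition proj_perp :: "L2 \<Rightarrow> L2 \<Rightarrow> L2" where
  "proj_perp \<theta> f = hardy_coproj f + \<theta> * hardy_proj (conj_L2 \<theta> * f)"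

definition dual_trunc_hankel :: "L2 \<Rightarrow> L2 \<Rightarrow> L2 \<Rightarrow> L2" where
  "dual_trunc_hankel \<theta> \<phi> h = proj_perp \<theta> (flip (\<phi> * h))"

definition compressed_shift :: "L2 \<Rightarrow> L2 \<Rightarrow> L2" where
  "compressed_shift \<theta> h = proj_perp \<theta> (zvar * h)"

definition compressed_shift_adj :: "L2 \<Rightarrow> L2 \<Rightarrow> L2" where
  "compressed_shift_adj \<theta> = adjoint_on (model_space_perp \<theta>) (compressed_shift \<theta>)"

definition beta_fn :: "L2 \<Rightarrow> L2 \<Rightarrow> L2" where
  "beta_fn \<theta> \<phi> = proj_perp \<theta> (conj_L2 \<phi> * (zvar * (1 - cnj (fourier_coeff \<theta> 0) *\<^sub>C flip \<theta>)))"

definition eta_fn :: "L2 \<Rightarrow> L2 \<Rightarrow> L2" where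
  "eta_fn \<theta> \<phi> = \<phi> * (\<theta> - fourier_coeff \<theta> 0 *\<^sub>C 1)"

definition delta_const :: "L2 \<Rightarrow> L2 \<Rightarrow> complex" where
  "delta_const \<theta> \<phi> = fourier_coeff \<theta> 0 *
     (fourier_coeff (flip (\<phi> * conj_L2 zvar)) 0
      - fourier_coeff \<theta> 0 * fourier_coeff (conj_L2 \<theta> * flip (\<phi> * conj_L2 zvar)) 0)"

end

theory Submission
  imports Defs "HOL-Complex_Analysis.Cauchy_Integral_Formula"
begin

text \<open>
  Write \<open>Q\<close> for the projection onto \<open>K\<^sup>\<bottom>\<close>, the orthogonal complement of the model space \<open>K\<close>,
  \<open>\<langle>\<cdot>, \<cdot>\<rangle>\<close> for the inner product, \<open>J\<close> for the flip and \<open>z\<^sup>*\<close> for the conjugate of \<open>z\<close>. The flip turns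
  multiplication by \<open>z\<^sup>*\<close> into multiplication by \<open>z\<close>, so \<open>J (\<phi> z\<^sup>* h) = z J (\<phi> h)\<close>; if the shift
  commuted with \<open>Q\<close>, the operator \<open>h \<mapsto> Q J (\<phi> h)\<close> would equal its conjugate by \<open>U\<^sup>*\<close>. The formula
  records the two places where it does not commute.

  The first is \<open>U\<^sup>* h = Q (z\<^sup>* h)\<close>. The complement of \<open>K\<close> consists of the antianalytic part and of
  \<open>\<theta> H\<^sup>2\<close>, and \<open>z\<^sup>*\<close> maps only the constant term of the latter outside, that is, the component of \<open>h\<close>
  along \<open>\<theta>\<close>. Since \<open>z\<^sup>* (\<theta> - \<theta>\<^sub>0)\<close> lies in \<open>K\<close>, this gives
  \<open>U\<^sup>* h = z\<^sup>* h - \<langle>h, \<theta>\<rangle> z\<^sup>* (\<theta> - \<theta>\<^sub>0)\<close> (\<open>compressed_shift_adj_formula\<close>), and hence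
  \<open>J (\<phi> U\<^sup>* h) = z f\<close> with \<open>f = J (\<phi> h) - \<langle>h, \<theta>\<rangle> J \<eta>\<close>.

  The second is \<open>U\<^sup>* Q (z f)\<close>, which differs from \<open>Q f\<close> by what the component \<open>k\<close> of \<open>z f\<close> in \<open>K\<close>
  contributes, namely \<open>Q (z\<^sup>* k) = k\<^sub>0 z\<^sup>*\<close>. The coefficient \<open>k\<^sub>0\<close> is \<open>\<langle>z f, 1 - cnj \<theta>\<^sub>0 \<theta>\<rangle>\<close>, because
  \<open>1 - cnj \<theta>\<^sub>0 \<theta>\<close> is the reproducing kernel of \<open>K\<close> at the origin
  (\<open>compressed_shift_adj_proj_zvar\<close>). Together these make the left-hand side equal to
  \<open>\<langle>h, \<theta>\<rangle> Q J \<eta> + \<langle>z f, 1 - cnj \<theta>\<^sub>0 \<theta>\<rangle> z\<^sup>*\<close>. Moving all operators in the last inner product to the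
  right turns its part coming from \<open>h\<close> into \<open>\<langle>h, \<beta>\<rangle>\<close>; the part coming from \<open>\<eta> = \<phi> \<theta> - \<theta>\<^sub>0 \<phi>\<close> is
  \<open>- \<langle>h, \<theta>\<rangle>\<close> times \<open>\<langle>\<theta>, \<beta>\<rangle> - \<delta>\<close>, where \<open>\<langle>\<theta>, \<beta>\<rangle>\<close> arises from \<open>\<phi> \<theta>\<close> by the same identity for
  \<open>h = \<theta>\<close>, and \<open>\<delta>\<close> from \<open>\<theta>\<^sub>0 \<phi>\<close> (\<open>delta_const_eq\<close>).

  Two analytic facts support this algebra. The Hardy projection exists because \<open>L\<^sup>2\<close> is complete
  and \<open>H\<^sup>2\<close>, being the orthogonal complement of the negative powers of \<open>z\<close>, is closed. And
  multiplication by \<open>\<theta>\<close> preserves \<open>H\<^sup>2\<close> (\<open>inner_mult_mem_H2\<close>), which is derived from the analytic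
  extension of \<open>\<theta>\<close> to the disk by expanding it in a power series on smaller circles.
\<close>

section \<open>The inner product on the space of square-integrable classes\<close>

lemma integrable_mult_cnj:
  assumes "square_integrable f" "square_integrable g"
  shows "integrable circle (\<lambda>z. f z * cnj (g z))"
proof (rule Bochner_Integration.integrable_bound)
  show "integrable circle (\<lambda>z. (cmod (f z))\<^sup>2 + (cmod (g z))\<^sup>2)"
    using assms by (simp add: square_integrable_def)
  show "(\<lambda>z. f z * cnj (g z)) \<in> borel_measurable circle"
    using assms by (auto simp: square_integrable_def intro!: borel_measurable_times cnj_borel_measurable)
  have "cmod (f z * cnj (g z)) \<le> norm ((cmod (f z))\<^sup>2 + (cmod (g z))\<^sup>2)" for z
  proof -
    have "2 * (cmod (f z) * cmod (g z)) \<le> (cmod (f z))\<^sup>2 + (cmod (g z))\<^sup>2"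
      using zero_le_power2[of "cmod (f z) - cmod (g z)"]
      by (simp add: power2_eq_square algebra_simps)
    moreover have "0 \<le> cmod (f z) * cmod (g z)" by simp
    ultimately show ?thesis by (simp add: norm_mult del: norm_ge_zero)
  qed
  then show "AE z in circle. cmod (f z * cnj (g z)) \<le> norm ((cmod (f z))\<^sup>2 + (cmod (g z))\<^sup>2)"
    by simp
qed

lemma cinner_add_left: "cinner (f + g) h = cinner f h + cinner g h"
  by transfer (simp add: distrib_right integrable_mult_cnj)

lemma cinner_scaleC_left: "cinner (c *\<^sub>C f) h = c * cinner f h"
  by transfer (simp add: mult.assoc)

lemma cinner_commute: "cinner g f = cnj (cinner f g)"
proof transfer
  fix f g :: "complex \<Rightarrow> complex"
  have "cnj (LINT z|circle. f z * cnj (g z)) = (LINT z|circle. cnj (f z * cnj (g z)))"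
    by (rule Bochner_Integration.integral_cnj[symmetric])
  then show "(LINT z|circle. g z * cnj (f z)) = cnj (LINT z|circle. f z * cnj (g z))"
    by (simp add: mult.commute)
qed

lemma cinner_add_right: "cinner h (f + g) = cinner h f + cinner h g"
  by (metis cinner_add_left cinner_commute complex_cnj_add)

lemma cinner_scaleC_right: "cinner h (c *\<^sub>C f) = cnj c * cinner h f"
  by (metis cinner_scaleC_left cinner_commute complex_cnj_mult)

lemma uminus_eq_scaleC: "- f = (-1) *\<^sub>C f"
  by transfer (auto simp: square_integrable_def)

lemma cinner_minus_left: "cinner (- f) h = - cinner f h"
  by (simp add: uminus_eq_scaleC cinner_scaleC_left)

lemma cinner_minus_right: "cinner h (- f) = - cinner h f"
  by (simp add: uminus_eq_scaleC cinner_scaleC_right)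

lemma cinner_diff_left: "cinner (f - g) h = cinner f h - cinner g h"
  using cinner_add_left[of f "- g" h] by (simp add: cinner_minus_left)

lemma cinner_diff_right: "cinner h (f - g) = cinner h f - cinner h g"
  using cinner_add_right[of h f "- g"] by (simp add: cinner_minus_right)

lemma cinner_zero_left: "cinner 0 f = 0"
  using cinner_diff_left[of 0 0 f] by simp

lemma cinner_zero_right: "cinner f 0 = 0"
  using cinner_diff_right[of f 0 0] by simp

lemmas cinner_linear = cinner_add_left cinner_add_right cinner_diff_left cinner_diff_right
  cinner_minus_left cinner_minus_right cinner_scaleC_left cinner_scaleC_right
  cinner_zero_left cinner_zero_right

lemma scaleC_add_right: "c *\<^sub>C (f + g) = c *\<^sub>C f + c *\<^sub>C g"
  by transfer (simp add: distrib_left[symmetric] square_integrable_scale square_integrable_add)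

lemma scaleC_add_left: "(a + b) *\<^sub>C f = a *\<^sub>C f + b *\<^sub>C f"
  by transfer (simp add: distrib_right[symmetric] square_integrable_scale)

lemma scaleC_scaleC: "a *\<^sub>C (b *\<^sub>C f) = (a * b) *\<^sub>C f"
  by transfer (simp add: square_integrable_scale mult.assoc)

lemma scaleC_diff_right: "c *\<^sub>C (f - g) = c *\<^sub>C f - c *\<^sub>C g"
  using scaleC_add_right[of c "f - g" g] by (simp add: algebra_simps)

lemma scaleC_diff_left: "(a - b) *\<^sub>C f = a *\<^sub>C f - b *\<^sub>C f"
  using scaleC_add_left[of "a - b" b f] by (simp add: algebra_simps)

lemma cinner_self_eq_integral:
  "square_integrable f \<Longrightarrow> cinner (abs_L2 f) (abs_L2 f) = complex_of_real (LINT z|circle. (cmod (f z))\<^sup>2)"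
  by (simp add: cinner.abs_eq complex_norm_square[symmetric] flip: of_real_power)

lemma L2_representative: obtains f where "square_integrable f" "F = abs_L2 f"
proof
  show "square_integrable (rep_L2 F)"
    using Quotient3_rep_reflp[OF Quotient3_L2] by blast
  show "F = abs_L2 (rep_L2 F)"
    using Quotient3_abs_rep[OF Quotient3_L2] by simp
qed

lemma abs_L2_eqI:
  assumes "square_integrable f" "square_integrable g" "AE z in circle. f z = g z"
  shows "abs_L2 f = abs_L2 g"
  using assms Quotient3_rel[OF Quotient3_L2, of f g] by blast

lemma cinner_self_real: "cinner F F = complex_of_real (Re (cinner F F))"
  by (rule L2_representative[of F]) (simp add: cinner_self_eq_integral)

lemma Re_cinner_self_nonneg: "0 \<le> Re (cinner F F)"
  by (rule L2_representative[of F]) (simp add: cinner_self_eq_integral)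

lemma cinner_self_eq_zero: "cinner F F = 0 \<longleftrightarrow> F = 0"
proof
  assume 0: "cinner F F = 0"
  obtain f where f: "square_integrable f" "F = abs_L2 f"
    by (rule L2_representative)
  have "(LINT z|circle. (cmod (f z))\<^sup>2) = 0"
    using 0 f by (simp add: cinner_self_eq_integral)
  then have "AE z in circle. (cmod (f z))\<^sup>2 = 0"
    using f by (subst (asm) integral_nonneg_eq_0_iff_AE) (auto simp: square_integrable_def)
  then have "AE z in circle. f z = 0" by simp
  then show "F = 0"
    using f by (auto simp: zero_L2_def square_integrable_def intro!: abs_L2_eqI)
qed (simp add: cinner_zero_left)

text \<open>
  Over the reals \<open>L\<^sup>2\<close> becomes an inner product space under the real part of the Hermitian form;
  norm, metric and topology are the same as for the complex structure.
\<close>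
instantiation L2 :: real_inner
begin

definition "scaleR_L2 r (f :: L2) = complex_of_real r *\<^sub>C f"
definition "inner_L2 (f :: L2) g = Re (cinner f g)"
definition "norm_L2 (f :: L2) = sqrt (Re (cinner f f))"
definition "sgn_L2 (f :: L2) = inverse (norm f) *\<^sub>R f"
definition "dist_L2 (f :: L2) g = norm (f - g)"
definition "(uniformity :: (L2 \<times> L2) filter) = (INF e\<in>{0<..}. principal {(x, y). dist x y < e})"
definition "open (U :: L2 set) = (\<forall>x\<in>U. eventually (\<lambda>(x', y). x' = x \<longrightarrow> y \<in> U) uniformity)"

instance
proof
  fix a b :: real and x y z :: L2
  show "a *\<^sub>R (x + y) = a *\<^sub>R x + a *\<^sub>R y"
    unfolding scaleR_L2_def
    by transfer (auto simp: distrib_left intro!: square_integrable_scale square_integrable_add)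
  show "(a + b) *\<^sub>R x = a *\<^sub>R x + b *\<^sub>R x"
    unfolding scaleR_L2_def
    by transfer (simp add: distrib_right[symmetric] square_integrable_scale flip: of_real_add)
  show "a *\<^sub>R b *\<^sub>R x = (a * b) *\<^sub>R x"
    unfolding scaleR_L2_def
    by transfer (simp add: square_integrable_scale mult.assoc[symmetric] flip: of_real_mult)
  show "1 *\<^sub>R x = x"
    unfolding scaleR_L2_def by transfer simp
  show "inner x y = inner y x"
    unfolding inner_L2_def by (subst cinner_commute) simp
  show "inner (x + y) z = inner x z + inner y z"
    by (simp add: inner_L2_def cinner_linear)
  show "inner (a *\<^sub>R x) y = a * inner x y"
    by (simp add: inner_L2_def scaleR_L2_def cinner_linear)
  show "0 \<le> inner x x"
    by (simp add: inner_L2_def Re_cinner_self_nonneg)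
  show "inner x x = 0 \<longleftrightarrow> x = 0"
    by (metis cinner_self_eq_zero cinner_self_real inner_L2_def of_real_0 zero_complex.sel(1))
qed (simp_all add: inner_L2_def norm_L2_def sgn_L2_def dist_L2_def uniformity_L2_def open_L2_def)

end

lemma norm_abs_L2:
  "square_integrable f \<Longrightarrow> norm (abs_L2 f) = sqrt (LINT z|circle. (cmod (f z))\<^sup>2)"
  by (simp add: norm_L2_def cinner_self_eq_integral)

text \<open>
  The real inner product only sees the real part, so the Cauchy--Schwarz inequality for the complex
  one is recovered by rotating the first argument.
\<close>
lemma cinner_Cauchy_Schwarz: "cmod (cinner f g) \<le> norm f * norm g"
proof (cases "cinner f g = 0")
  case False
  define u where "u = cnj (sgn (cinner f g))"
  have u: "cmod u = 1" using False by (simp add: u_def norm_sgn)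
  have "u * cinner f g = complex_of_real (cmod (cinner f g))"
    by (simp add: u_def sgn_eq mult.commute complex_norm_square[symmetric] power2_eq_square)
  then have "cmod (cinner f g) = Re (cinner (u *\<^sub>C f) g)"
    by (simp add: cinner_linear)
  also have "\<dots> \<le> norm (u *\<^sub>C f) * norm g"
    using norm_cauchy_schwarz[of "u *\<^sub>C f" g] by (simp add: inner_L2_def)
  also have "norm (u *\<^sub>C f) = norm f"
  proof -
    have "u * cnj u = 1"
      using u complex_norm_square[of u] by simp
    moreover have "cinner (u *\<^sub>C f) (u *\<^sub>C f) = (u * cnj u) * cinner f f"
      by (simp only: cinner_linear mult_ac)
    ultimately show ?thesis by (simp add: norm_L2_def)
  qed
  finally show ?thesis .
qed simp

section \<open>Completeness\<close>

text \<open>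
  Riesz--Fischer. On a finite measure space an \<open>L\<^sup>2\<close>-Cauchy sequence is \<open>L\<^sup>1\<close>-Cauchy, so a
  subsequence converges almost everywhere; Fatou's lemma shows that its pointwise limit is also
  the limit in \<open>L\<^sup>2\<close>.
\<close>
instance L2 :: complete_space
proof
  fix X :: "nat \<Rightarrow> L2"
  assume X: "Cauchy X"
  interpret finite_measure circle by (rule finite_measure_circle)
  obtain f where f: "\<And>n. square_integrable (f n)" "\<And>n. X n = abs_L2 (f n)"
  proof -
    have "\<exists>f. square_integrable f \<and> X n = abs_L2 f" for n
      by (rule L2_representative[of "X n"]) blast
    then show ?thesis using that by metis
  qed
  have fm [measurable]: "f n \<in> borel_measurable circle" for n
    using f by (auto simp: square_integrable_def)
  have diff: "square_integrable (\<lambda>z. g z - h z)" "abs_L2 g - abs_L2 h = abs_L2 (\<lambda>z. g z - h z)"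
    if "square_integrable g" "square_integrable h" for g h
  proof -
    show "square_integrable (\<lambda>z. g z - h z)"
      using square_integrable_add[OF that(1) square_integrable_scale[OF that(2), of "-1"]] by simp
    show "abs_L2 g - abs_L2 h = abs_L2 (\<lambda>z. g z - h z)"
      using that by (simp add: minus_L2.abs_eq)
  qed
  have dX: "dist (X i) (X j) = sqrt (LINT z|circle. (cmod (f i z - f j z))\<^sup>2)" for i j
    by (simp add: dist_L2_def f diff norm_abs_L2)
  have one: "square_integrable (\<lambda>z. 1)"
    by (rule square_integrable_bounded[where C = 1]) auto
  have L1: "(LINT z|circle. cmod (g z)) \<le> norm (abs_L2 g) * norm (1 :: L2)"
    if g: "square_integrable g" for g
  proof -
    have a: "square_integrable (\<lambda>z. complex_of_real (cmod (g z)))"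
      using g by (auto simp: square_integrable_def)
    have "complex_of_real (LINT z|circle. cmod (g z)) = cinner (abs_L2 (\<lambda>z. cmod (g z))) (abs_L2 (\<lambda>z. 1))"
      using a one by (simp add: cinner.abs_eq)
    then have "\<bar>LINT z|circle. cmod (g z)\<bar> \<le> norm (abs_L2 (\<lambda>z. complex_of_real (cmod (g z)))) * norm (1 :: L2)"
      using cinner_Cauchy_Schwarz by (metis norm_of_real one_L2_def)
    also have "norm (abs_L2 (\<lambda>z. complex_of_real (cmod (g z)))) = norm (abs_L2 g)"
      using a g by (simp add: norm_abs_L2)
    finally show ?thesis by simp
  qed
  have fi: "integrable circle (f n)" for n
    using integrable_mult_cnj[OF f(1) one] by simp
  have "\<exists>N. \<forall>i\<ge>N. \<forall>j\<ge>N. (LINT z|circle. norm (f i z - f j z)) < e" if "e > 0" for e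
  proof -
    \<comment> \<open>adding 1 keeps the divisor positive without computing the norm of the constant function\<close>
    define K where "K = norm (1 :: L2) + 1"
    have K: "K > 0" unfolding K_def by (simp add: add_nonneg_pos)
    obtain N where N: "\<And>i j. i \<ge> N \<Longrightarrow> j \<ge> N \<Longrightarrow> dist (X i) (X j) < e / K"
      using X K \<open>e > 0\<close> unfolding Cauchy_def by (metis divide_pos_pos)
    have "(LINT z|circle. norm (f i z - f j z)) < e" if "i \<ge> N" "j \<ge> N" for i j
    proof -
      have "(LINT z|circle. norm (f i z - f j z)) \<le> dist (X i) (X j) * norm (1 :: L2)"
        using L1[OF diff(1)[OF f(1) f(1)]] by (simp add: dist_L2_def f diff)
      also have "\<dots> \<le> dist (X i) (X j) * K" by (simp add: K_def mult_left_mono)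
      also have "\<dots> < e" using N[OF that] K by (simp add: field_simps)
      finally show ?thesis .
    qed
    then show ?thesis by blast
  qed
  from cauchy_L1_AE_cauchy_subseq[OF fi this]
  obtain r where r: "strict_mono r" "AE z in circle. Cauchy (\<lambda>i. f (r i) z)" by auto
  define g where "g z = lim (\<lambda>i. f (r i) z)" for z
  have gm [measurable]: "g \<in> borel_measurable circle"
    unfolding g_def by (rule borel_measurable_lim_metric) measurable
  have ae: "AE z in circle. (\<lambda>i. f (r i) z) \<longlonglongrightarrow> g z"
    using r(2) by (rule AE_mp) (auto simp: g_def Cauchy_convergent_iff convergent_LIMSEQ_iff)
  have r_ge: "i \<le> r i" for i
    using r(1) by (simp add: strict_mono_imp_increasing)
  have close: "integrable circle (\<lambda>z. (cmod (f n z - g z))\<^sup>2) \<and>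
      (LINT z|circle. (cmod (f n z - g z))\<^sup>2) \<le> e\<^sup>2"
    if N: "\<And>i j. i \<ge> N \<Longrightarrow> j \<ge> N \<Longrightarrow> dist (X i) (X j) < e" and n: "n \<ge> N" and e: "e > 0" for n N e
  proof -
    have "(\<integral>\<^sup>+z. ennreal ((cmod (f n z - g z))\<^sup>2) \<partial>circle)
        \<le> (\<integral>\<^sup>+z. liminf (\<lambda>i. ennreal ((cmod (f n z - f (r i) z))\<^sup>2)) \<partial>circle)"
    proof (rule nn_integral_mono_AE)
      show "AE z in circle. ennreal ((cmod (f n z - g z))\<^sup>2)
          \<le> liminf (\<lambda>i. ennreal ((cmod (f n z - f (r i) z))\<^sup>2))"
        using ae
      proof eventually_elim
        case (elim z)
        have "(\<lambda>i. ennreal ((cmod (f n z - f (r i) z))\<^sup>2)) \<longlonglongrightarrow> ennreal ((cmod (f n z - g z))\<^sup>2)"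
          by (intro tendsto_intros elim)
        from lim_imp_Liminf[OF _ this] show ?case by simp
      qed
    qed
    also have "\<dots> \<le> liminf (\<lambda>i. \<integral>\<^sup>+z. ennreal ((cmod (f n z - f (r i) z))\<^sup>2) \<partial>circle)"
      by (rule nn_integral_liminf) measurable
    also have "\<dots> \<le> ennreal (e\<^sup>2)"
    proof (rule Liminf_le, simp)
      have "(\<integral>\<^sup>+z. ennreal ((cmod (f n z - f (r i) z))\<^sup>2) \<partial>circle) \<le> ennreal (e\<^sup>2)" if "i \<ge> N" for i
      proof -
        have "integrable circle (\<lambda>z. (cmod (f n z - f (r i) z))\<^sup>2)"
          using diff(1)[OF f(1) f(1)] by (simp add: square_integrable_def)
        then have "(\<integral>\<^sup>+z. ennreal ((cmod (f n z - f (r i) z))\<^sup>2) \<partial>circle)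
            = ennreal (LINT z|circle. (cmod (f n z - f (r i) z))\<^sup>2)"
          by (intro nn_integral_eq_integral) auto
        moreover have "(LINT z|circle. (cmod (f n z - f (r i) z))\<^sup>2) = (dist (X n) (X (r i)))\<^sup>2"
          by (simp add: dX)
        moreover have "(dist (X n) (X (r i)))\<^sup>2 \<le> e\<^sup>2"
          using N[OF n, of "r i"] r_ge[of i] that by (intro power_mono) auto
        ultimately show ?thesis by (simp add: ennreal_leI)
      qed
      then show "\<forall>\<^sub>F i in sequentially.
          (\<integral>\<^sup>+z. ennreal ((cmod (f n z - f (r i) z))\<^sup>2) \<partial>circle) \<le> ennreal (e\<^sup>2)"
        unfolding eventually_sequentially by blast
    qed
    finally have le: "(\<integral>\<^sup>+z. ennreal ((cmod (f n z - g z))\<^sup>2) \<partial>circle) \<le> ennreal (e\<^sup>2)" .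
    have "integrable circle (\<lambda>z. (cmod (f n z - g z))\<^sup>2)"
      by (rule integrableI_bounded) (use le_less_trans[OF le ennreal_less_top] in auto)
    moreover from this have "ennreal (LINT z|circle. (cmod (f n z - g z))\<^sup>2) \<le> ennreal (e\<^sup>2)"
      using le by (subst nn_integral_eq_integral[symmetric]) auto
    ultimately show ?thesis by simp
  qed
  have ex: "\<exists>N. \<forall>i\<ge>N. \<forall>j\<ge>N. dist (X i) (X j) < e" if "e > 0" for e
    using X that unfolding Cauchy_def by blast
  obtain N where "\<And>i j. i \<ge> N \<Longrightarrow> j \<ge> N \<Longrightarrow> dist (X i) (X j) < 1" using ex[of 1] by auto
  from close[OF this, of N] have "square_integrable (\<lambda>z. f N z - g z)"
    by (simp add: square_integrable_def)
  from diff(1)[OF f(1)[of N] this] have g: "square_integrable g" by simp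
  have "X \<longlonglongrightarrow> abs_L2 g"
  proof (rule metric_LIMSEQ_I)
    fix e :: real assume "e > 0"
    then obtain N where N: "\<And>i j. i \<ge> N \<Longrightarrow> j \<ge> N \<Longrightarrow> dist (X i) (X j) < e / 2"
      using ex[of "e / 2"] by auto
    have "dist (X n) (abs_L2 g) < e" if "n \<ge> N" for n
    proof -
      have "dist (X n) (abs_L2 g) = sqrt (LINT z|circle. (cmod (f n z - g z))\<^sup>2)"
        by (simp add: dist_L2_def f g diff norm_abs_L2)
      also have "\<dots> \<le> sqrt ((e / 2)\<^sup>2)"
        using close[OF N that] \<open>e > 0\<close> by (intro real_sqrt_le_mono) simp
      also have "\<dots> < e" using \<open>e > 0\<close> by (simp add: real_sqrt_abs del: power_divide)
      finally show ?thesis .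
    qed
    then show "\<exists>N. \<forall>n\<ge>N. dist (X n) (abs_L2 g) < e" by blast
  qed
  then show "convergent X" by (rule convergentI)
qed

section \<open>Orthogonal projections\<close>

text \<open>
  A minimising sequence for the distance is Cauchy by the parallelogram law; at its limit the
  quadratic \<open>t \<mapsto> \<parallel>x - p - t s\<parallel>\<^sup>2\<close> has its minimum at \<open>t = 0\<close>.
\<close>
lemma closed_subspace_projection_exists:
  fixes S :: "'a :: {real_inner, complete_space} set"
  assumes S: "subspace S" "closed S"
  obtains p where "p \<in> S" "\<And>s. s \<in> S \<Longrightarrow> inner (x - p) s = 0"
proof -
  have ne: "S \<noteq> {}" using S(1) subspace_0 by blast
  define d where "d = infdist x S"
  have d0: "0 \<le> d" by (simp add: d_def infdist_nonneg)
  have dle: "d \<le> norm (x - s)" if "s \<in> S" for s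
    using infdist_le[OF that, of x] by (simp add: d_def dist_norm)
  have "\<exists>p\<in>S. norm (x - p) < d + 1 / real (Suc n)" for n
  proof -
    have "\<exists>p\<in>S. dist x p < d + 1 / real (Suc n)"
      using ne unfolding d_def infdist_notempty[OF ne]
      by (intro cInf_lessD[of "dist x ` S", simplified]) auto
    then show ?thesis by (simp add: dist_norm)
  qed
  then obtain q where q: "\<And>n. q n \<in> S" "\<And>n. norm (x - q n) < d + 1 / real (Suc n)"
    by metis
  have lim: "(\<lambda>n. d + 1 / real (Suc n)) \<longlonglongrightarrow> d + 0"
    by (intro tendsto_intros LIMSEQ_Suc[OF lim_1_over_n])
  define e where "e n = (d + 1 / real (Suc n))\<^sup>2 - d\<^sup>2" for n
  have e: "e \<longlonglongrightarrow> 0"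
    unfolding e_def using tendsto_diff[OF tendsto_power[OF lim, of 2] tendsto_const[of "d\<^sup>2"]] by simp
  \<comment> \<open>the midpoint of two near-minimisers lies in \<open>S\<close>, hence at distance at least \<open>d\<close> from \<open>x\<close>\<close>
  have par: "(norm (q m - q n))\<^sup>2 \<le> 2 * e m + 2 * e n" for m n
  proof -
    have "(1/2) *\<^sub>R (q m + q n) \<in> S"
      using S(1) q(1) by (intro subspace_scale subspace_add)
    then have "d\<^sup>2 \<le> (norm (x - (1/2) *\<^sub>R (q m + q n)))\<^sup>2"
      using dle d0 by (intro power_mono) auto
    moreover have "(norm (x - q k))\<^sup>2 \<le> d\<^sup>2 + e k" for k
      using q(2)[of k] power_mono[of "norm (x - q k)" "d + 1 / real (Suc k)" 2] by (simp add: e_def)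
    from this[of m] this[of n]
    have "2 * (norm (x - q m))\<^sup>2 + 2 * (norm (x - q n))\<^sup>2 \<le> 4 * d\<^sup>2 + 2 * e m + 2 * e n" by simp
    moreover have "(norm (q m - q n))\<^sup>2 + 4 * (norm (x - (1/2) *\<^sub>R (q m + q n)))\<^sup>2
        = 2 * (norm (x - q m))\<^sup>2 + 2 * (norm (x - q n))\<^sup>2"
      unfolding power2_norm_eq_inner
      by (simp add: inner_diff_left inner_diff_right inner_add_left inner_add_right inner_commute
          algebra_simps)
    ultimately show ?thesis by simp
  qed
  have "Cauchy q"
  proof (rule CauchyI)
    fix \<epsilon> :: real assume \<epsilon>: "\<epsilon> > 0"
    then obtain N where N: "\<And>n. n \<ge> N \<Longrightarrow> \<bar>e n\<bar> < \<epsilon>\<^sup>2 / 4"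
      using LIMSEQ_D[OF e, of "\<epsilon>\<^sup>2 / 4"] by auto
    have "norm (q m - q n) < \<epsilon>" if "m \<ge> N" "n \<ge> N" for m n
    proof (rule power2_less_imp_less)
      show "(norm (q m - q n))\<^sup>2 < \<epsilon>\<^sup>2" using par[of m n] N[OF that(1)] N[OF that(2)] by linarith
    qed (use \<epsilon> in simp)
    then show "\<exists>M. \<forall>m\<ge>M. \<forall>n\<ge>M. norm (q m - q n) < \<epsilon>" by blast
  qed
  then obtain p where p: "q \<longlonglongrightarrow> p" using Cauchy_convergent convergent_def by blast
  then have pS: "p \<in> S" using S(2) q(1) closed_sequentially by blast
  have "(\<lambda>n. norm (x - q n)) \<longlonglongrightarrow> norm (x - p)"
    by (intro tendsto_intros p)
  from LIMSEQ_le[OF this lim] have pd: "norm (x - p) \<le> d"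
    using q(2) by (auto intro: less_imp_le)
  have "inner (x - p) s = 0" if s: "s \<in> S" for s
  proof (cases "s = 0")
    case False
    \<comment> \<open>\<open>t\<close> is the minimiser of the quadratic\<close>
    define c t where "c = inner (x - p) s" and "t = c / inner s s"
    have "p + t *\<^sub>R s \<in> S" using S(1) pS s by (intro subspace_add subspace_scale)
    then have "(norm (x - p))\<^sup>2 \<le> (norm (x - (p + t *\<^sub>R s)))\<^sup>2"
      using pd dle by (intro power_mono) (auto intro: order_trans)
    also have "\<dots> = (norm (x - p))\<^sup>2 - 2 * t * c + t\<^sup>2 * inner s s"
      unfolding power2_norm_eq_inner c_def
      by (simp add: inner_diff_left inner_diff_right inner_add_left inner_add_right inner_commute
          algebra_simps power2_eq_square)
    also have "\<dots> = (norm (x - p))\<^sup>2 - c\<^sup>2 / inner s s"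
      using False by (simp add: t_def power2_eq_square field_simps)
    finally have "c\<^sup>2 / inner s s \<le> 0" by simp
    moreover have "inner s s > 0" using False by simp
    ultimately have "c\<^sup>2 \<le> 0" by (simp add: divide_le_0_iff)
    then show ?thesis by (simp add: c_def)
  qed simp
  with pS show ?thesis by (rule that)
qed

text \<open>Complex orthogonality is real orthogonality to a vector and to its multiple by \<open>\<i>\<close>.\<close>
lemma cinner_eq_zero_iff_inner: "cinner f g = 0 \<longleftrightarrow> inner f g = 0 \<and> inner f (\<i> *\<^sub>C g) = 0"
  by (simp add: inner_L2_def cinner_linear complex_eq_iff)

lemma ortho_add: "f \<in> ortho S \<Longrightarrow> g \<in> ortho S \<Longrightarrow> f + g \<in> ortho S"
  and ortho_diff: "f \<in> ortho S \<Longrightarrow> g \<in> ortho S \<Longrightarrow> f - g \<in> ortho S"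
  and ortho_scaleC: "f \<in> ortho S \<Longrightarrow> c *\<^sub>C f \<in> ortho S"
  by (simp_all add: ortho_def cinner_linear)

lemma ortho_closed_subspace: "subspace (ortho S)" "closed (ortho S)"
proof -
  show "subspace (ortho S)"
    unfolding subspace_def scaleR_L2_def by (auto simp: ortho_def cinner_linear)
  have "ortho S = (\<Inter>g\<in>S. {f. inner f g = 0} \<inter> {f. inner f (\<i> *\<^sub>C g) = 0})"
    unfolding ortho_def cinner_eq_zero_iff_inner by auto
  then show "closed (ortho S)"
    by (auto intro!: closed_INT closed_Int closed_Collect_eq continuous_intros)
qed

lemma ortho_inter_self: "f \<in> S \<Longrightarrow> f \<in> ortho S \<Longrightarrow> f = 0"
  by (auto simp: ortho_def cinner_self_eq_zero)

text \<open>
  Every orthogonal complement is a closed subspace, so the definite description defining the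
  projection onto it denotes.
\<close>
lemma ortho_proj_ortho:
  "ortho_proj (ortho T) f \<in> ortho T" "f - ortho_proj (ortho T) f \<in> ortho (ortho T)"
proof -
  let ?S = "ortho T"
  obtain p where p: "p \<in> ?S" "\<And>s. s \<in> ?S \<Longrightarrow> inner (f - p) s = 0"
    using closed_subspace_projection_exists[OF ortho_closed_subspace] by blast
  have fp: "f - p \<in> ortho ?S"
    using p(2) ortho_scaleC[of _ T] by (simp add: ortho_def[of ?S] cinner_eq_zero_iff_inner)
  have uniq: "q = p" if "q \<in> ?S" "f - q \<in> ortho ?S" for q
  proof -
    have "q - p \<in> ?S" using that(1) p(1) by (rule ortho_diff)
    moreover have "(f - p) - (f - q) \<in> ortho ?S" using fp that(2) by (rule ortho_diff)
    ultimately have "q - p = 0" using ortho_inter_self[of "q - p" ?S] by simp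
    then show ?thesis by simp
  qed
  have "ortho_proj ?S f \<in> ?S \<and> f - ortho_proj ?S f \<in> ortho ?S"
    unfolding ortho_proj_def by (rule theI[of _ p]) (use p(1) fp uniq in blast)+
  then show "ortho_proj ?S f \<in> ?S" "f - ortho_proj ?S f \<in> ortho ?S" by auto
qed

section \<open>Multiplication by bounded functions, conjugation and the flip\<close>

text \<open>
  The product on \<open>L\<^sup>2\<close> is the pointwise one only if that is square integrable. A bounded factor
  guarantees it, which is why distributivity, adjointness and interchange of factors are stated for
  bounded multipliers: integrability of the products concerned settles the case distinctions.
\<close>
lemma square_integrable_mult:
  assumes "\<exists>C. AE z in circle. cmod (b z) \<le> C" "square_integrable b" "square_integrable f"
  shows "square_integrable (\<lambda>z. b z * f z)"
proof -
  obtain C where C: "AE z in circle. cmod (b z) \<le> C" using assms(1) by blast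
  have m: "(\<lambda>z. b z * f z) \<in> borel_measurable circle"
    using assms by (auto simp: square_integrable_def)
  have "integrable circle (\<lambda>z. (cmod (b z * f z))\<^sup>2)"
  proof (rule Bochner_Integration.integrable_bound)
    show "integrable circle (\<lambda>z. C\<^sup>2 * (cmod (f z))\<^sup>2)"
      using assms(3) by (simp add: square_integrable_def)
    show "AE z in circle. norm ((cmod (b z * f z))\<^sup>2) \<le> norm (C\<^sup>2 * (cmod (f z))\<^sup>2)"
      using C by eventually_elim (auto simp: norm_mult power_mult_distrib intro!: mult_right_mono power_mono)
  qed (use m in measurable)
  with m show ?thesis by (simp add: square_integrable_def)
qed

lemma L2_mult_commute: "f * g = g * (f :: L2)"
  by transfer (simp add: mult.commute square_integrable_def)

lemma mult_one_L2: "f * 1 = (f :: L2)"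
  by transfer simp

lemma conj_conj_L2 [simp]: "conj_L2 (conj_L2 f) = f"
  by transfer simp

lemma essentially_bounded_conj: "essentially_bounded b \<Longrightarrow> essentially_bounded (conj_L2 b)"
  by transfer simp

lift_definition unimodular :: "L2 \<Rightarrow> bool" is "\<lambda>f. AE z in circle. cmod (f z) = 1"
  by (rule AE_circle_cong[where R = "\<lambda>z w. cmod w = 1"]) blast

lemma unimodular_zvar: "unimodular zvar"
  by transfer (auto simp: space_circle intro!: AE_I2)

lemma unimodular_conj: "unimodular u \<Longrightarrow> unimodular (conj_L2 u)"
  by transfer simp

lemma unimodular_inner_function: "inner_function \<theta> \<Longrightarrow> unimodular \<theta>"
  by transfer blast

lemma essentially_bounded_unimodular: "unimodular u \<Longrightarrow> essentially_bounded u"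
proof transfer
  fix u :: "complex \<Rightarrow> complex"
  assume "AE z in circle. cmod (u z) = 1"
  then have "AE z in circle. cmod (u z) \<le> 1" by eventually_elim simp
  then show "\<exists>C. AE z in circle. cmod (u z) \<le> C" ..
qed

context
  fixes b :: L2
  assumes b: "essentially_bounded b"
begin

lemma mult_add_L2: "b * (f + g) = b * f + b * g"
  using b by transfer (simp add: square_integrable_mult square_integrable_add distrib_left[symmetric])

lemma mult_scaleC_L2: "b * (c *\<^sub>C f) = c *\<^sub>C (b * f)"
  using b by transfer
    (use square_integrable_mult square_integrable_scale in \<open>auto simp: mult.left_commute\<close>)

lemma mult_diff_L2: "b * (f - g) = b * f - b * g"
  using mult_add_L2[of "f - g" g] by (simp add: algebra_simps)

lemma cinner_mult_left: "cinner (b * f) g = cinner f (conj_L2 b * g)"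
  using b
proof transfer
  fix b f g :: "complex \<Rightarrow> complex"
  assume a: "square_integrable b \<and> square_integrable b \<and> (AE z in circle. b z = b z)"
    "square_integrable f \<and> square_integrable f \<and> (AE z in circle. f z = f z)"
    "square_integrable g \<and> square_integrable g \<and> (AE z in circle. g z = g z)"
    and C: "\<exists>C. AE z in circle. cmod (b z) \<le> C"
  have 1: "square_integrable (\<lambda>z. b z * f z)" "square_integrable (\<lambda>z. cnj (b z) * g z)"
    using a C square_integrable_cnj[of b] square_integrable_mult[of b f]
      square_integrable_mult[of "\<lambda>z. cnj (b z)" g] by simp_all
  have 2: "b z * f z * cnj (g z) = f z * cnj (cnj (b z) * g z)" for z by simp
  show "(LINT z|circle. (if square_integrable (\<lambda>z. b z * f z) then \<lambda>z. b z * f z else (\<lambda>_. 0)) z * cnj (g z))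
    = (LINT z|circle. f z * cnj ((if square_integrable (\<lambda>z. cnj (b z) * g z)
        then \<lambda>z. cnj (b z) * g z else (\<lambda>_. 0)) z))"
    by (simp only: 1 2 if_True)
qed

lemma flip_mult: "flip (b * f) = flip b * flip f"
  using b
proof transfer
  fix b f :: "complex \<Rightarrow> complex"
  assume a: "square_integrable b \<and> square_integrable b \<and> (AE z in circle. b z = b z)"
    "square_integrable f \<and> square_integrable f \<and> (AE z in circle. f z = f z)"
    and C: "\<exists>C. AE z in circle. cmod (b z) \<le> C"
  have 1: "square_integrable (\<lambda>z. b z * f z)"
    using a C by (auto intro!: square_integrable_mult)
  have 2: "square_integrable (\<lambda>z. b (cnj z) * f (cnj z))"
    using square_integrable_flip[OF 1] .
  let ?l = "\<lambda>z. (if square_integrable (\<lambda>z. b z * f z) then \<lambda>z. b z * f z else (\<lambda>_. 0)) (cnj z)"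
  let ?r = "if square_integrable (\<lambda>z. b (cnj z) * f (cnj z)) then \<lambda>z. b (cnj z) * f (cnj z) else (\<lambda>_. 0)"
  show "square_integrable ?l \<and> square_integrable ?r \<and> (AE z in circle. ?l z = ?r z)"
    by (simp add: 1 2)
qed

lemma mult_left_commute_L2: "essentially_bounded c \<Longrightarrow> b * (c * f) = c * (b * f)"
  using b by transfer (simp add: square_integrable_mult mult.left_commute)

end

lemma conj_mult_cancel:
  assumes "unimodular u"
  shows "conj_L2 u * (u * f) = f"
  using essentially_bounded_unimodular[OF assms] assms
proof transfer
  fix u f :: "complex \<Rightarrow> complex"
  assume a: "square_integrable u \<and> square_integrable u \<and> (AE z in circle. u z = u z)"
    "square_integrable f \<and> square_integrable f \<and> (AE z in circle. f z = f z)"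
    and C: "\<exists>C. AE z in circle. cmod (u z) \<le> C"
    and u: "AE z in circle. cmod (u z) = 1"
  have 1: "square_integrable (\<lambda>z. u z * f z)"
    using a C by (auto intro!: square_integrable_mult)
  have 2: "square_integrable (\<lambda>z. cnj (u z) * (u z * f z))"
    using 1 a C square_integrable_cnj[of u]
      square_integrable_mult[of "\<lambda>z. cnj (u z)" "\<lambda>z. u z * f z"] by simp
  have 3: "AE z in circle. cnj (u z) * (u z * f z) = f z"
    using u
  proof eventually_elim
    case (elim z)
    then have "u z * cnj (u z) = 1" using complex_norm_square[of "u z"] by simp
    then have "(cnj (u z) * u z) * f z = f z" by (simp only: mult.commute mult_1_left mult_1_right)
    then show ?case by (simp only: mult.assoc)
  qed
  let ?m = "if square_integrable (\<lambda>z. u z * f z) then \<lambda>z. u z * f z else (\<lambda>_. 0)"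
  let ?l = "if square_integrable (\<lambda>z. cnj (u z) * ?m z) then \<lambda>z. cnj (u z) * ?m z else (\<lambda>_. 0)"
  show "square_integrable ?l \<and> square_integrable f \<and> (AE z in circle. ?l z = f z)"
    unfolding if_P[OF 1] if_P[OF 2] using a 2 3 by blast
qed

lemma mult_conj_cancel: "unimodular u \<Longrightarrow> u * (conj_L2 u * f) = f"
  using conj_mult_cancel[OF unimodular_conj] by simp

lemma flip_flip: "flip (flip f) = f"
  by transfer simp

lemma flip_add: "flip (f + g) = flip f + flip g"
  by transfer (simp add: square_integrable_flip square_integrable_add)

lemma flip_diff: "flip (f - g) = flip f - flip g"
  using flip_add[of "f - g" g] by (simp add: algebra_simps)

lemma flip_scaleC: "flip (c *\<^sub>C f) = c *\<^sub>C flip f"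
  by transfer (simp add: square_integrable_flip square_integrable_scale)

lemma flip_one: "flip 1 = 1"
  by transfer (simp add: square_integrable_bounded[where C = 1])

lemma flip_zvar: "flip zvar = conj_L2 zvar"
  by transfer (auto intro!: square_integrable_bounded[where C = 1] borel_measurable_circle borel_measurable_continuous_onI continuous_intros)

lemma cinner_flip: "cinner (flip f) g = cinner f (flip g)"
proof transfer
  fix f g :: "complex \<Rightarrow> complex"
  assume a: "square_integrable f \<and> square_integrable f \<and> (AE z in circle. f z = f z)"
    "square_integrable g \<and> square_integrable g \<and> (AE z in circle. g z = g z)"
  have "(LINT z|circle. f z * cnj (g (cnj z))) = (LINT z|distr circle circle cnj. f z * cnj (g (cnj z)))"
    by (simp only: distr_cnj_circle)
  also have "\<dots> = (LINT z|circle. f (cnj z) * cnj (g z))"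
  proof (subst integral_distr[OF cnj_measurable_circle])
    show "(\<lambda>z. f z * cnj (g (cnj z))) \<in> borel_measurable circle"
      using a square_integrable_flip[of g]
      by (auto simp: square_integrable_def intro!: borel_measurable_times cnj_borel_measurable)
  qed simp
  finally show "(LINT z|circle. f (cnj z) * cnj (g z)) = (LINT z|circle. f z * cnj (g (cnj z)))" ..
qed

section \<open>Fourier coefficients and the Hardy space\<close>

lemma cnj_eq_inverse_circle:
  assumes "z \<in> space circle"
  shows "cnj z = inverse z"
proof -
  have "z * cnj z = 1" using assms complex_norm_square[of z] by (simp add: space_circle)
  then show ?thesis by (rule inverse_unique[symmetric])
qed

lift_definition circle_power :: "int \<Rightarrow> L2" is "\<lambda>k z. z powi k"
  by (auto intro!: square_integrable_bounded[where C = 1] borel_measurable_circle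
      simp: power_int_def norm_power norm_inverse)

lemma fourier_coeff_eq_cinner: "fourier_coeff f k = cinner f (circle_power k)"
  by transfer (rule Bochner_Integration.integral_cong,
    simp_all add: cnj_eq_inverse_circle power_int_inverse power_int_minus)

lemma circle_power_0: "circle_power 0 = 1"
  by transfer (simp add: square_integrable_bounded[where C = 1])

lemma conj_zvar_mult_circle_power: "conj_L2 zvar * circle_power k = circle_power (k - 1)"
proof transfer
  fix k :: int
  have m: "square_integrable (\<lambda>z. z powi l)" for l
    by (auto intro!: square_integrable_bounded[where C = 1] borel_measurable_circle
      simp: power_int_def norm_power norm_inverse)
  have e: "cnj z * z powi k = z powi (k - 1)" if "z \<in> space circle" for z
  proof -
    have "z \<noteq> 0" using that by (auto simp: space_circle)
    then show ?thesis using that by (simp add: cnj_eq_inverse_circle power_int_diff divide_inverse mult.commute)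
  qed
  have 1: "square_integrable (\<lambda>z. cnj z * z powi k)"
  proof (subst square_integrable_cong_AE)
    show "(\<lambda>z. z powi (k - 1)) \<in> borel_measurable circle" "square_integrable (\<lambda>z. z powi (k - 1))"
      using m by (auto simp: square_integrable_def)
    show "(\<lambda>z. cnj z * z powi k) \<in> borel_measurable circle"
      using m[of k] by (intro borel_measurable_times cnj_borel_measurable[OF borel_measurable_circle])
        (auto simp: square_integrable_def)
    show "AE z in circle. cnj z * z powi k = z powi (k - 1)"
      using e by (auto intro!: AE_I2)
  qed
  let ?l = "if square_integrable (\<lambda>z. cnj z * z powi k) then \<lambda>z. cnj z * z powi k else (\<lambda>_. 0)"
  show "square_integrable ?l \<and> square_integrable (\<lambda>z. z powi (k - 1)) \<and> (AE z in circle. ?l z = z powi (k - 1))"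
    using m 1 e by (auto intro!: AE_I2)
qed

lemma fourier_coeff_linear:
  "fourier_coeff (f + g) k = fourier_coeff f k + fourier_coeff g k"
  "fourier_coeff (f - g) k = fourier_coeff f k - fourier_coeff g k"
  "fourier_coeff (c *\<^sub>C f) k = c * fourier_coeff f k"
  by (simp_all add: fourier_coeff_eq_cinner cinner_linear)

lemma fourier_coeff_zvar_mult: "fourier_coeff (zvar * f) k = fourier_coeff f (k - 1)"
  by (simp add: fourier_coeff_eq_cinner cinner_mult_left[OF essentially_bounded_unimodular[OF unimodular_zvar]]
      conj_zvar_mult_circle_power)

lemma fourier_coeff_conj_zvar_mult: "fourier_coeff (conj_L2 zvar * f) k = fourier_coeff f (k + 1)"
  using fourier_coeff_zvar_mult[of "conj_L2 zvar * f" "k + 1"] by (simp add: mult_conj_cancel unimodular_zvar)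

text \<open>
  The powers of \<open>z\<close> other than the constant one have mean zero: in the angle \<open>t\<close> they are
  \<open>cis (- k t)\<close>, with the periodic primitive \<open>\<i> / k cis (- k t)\<close>.
\<close>
lemma fourier_coeff_one: "fourier_coeff 1 k = (if k = 0 then 1 else 0)"
proof transfer
  fix k :: int
  have m [measurable]: "(\<lambda>z::complex. z powi l) \<in> borel_measurable borel" for l
    by (simp add: power_int_def)
  have m': "(\<lambda>z::complex. z powi l) \<in> borel_measurable (restrict_space borel (sphere 0 1))" for l
    by (rule measurable_restrict_space1) measurable
  have c [measurable]: "cis \<in> borel_measurable borel"
    by (intro borel_measurable_continuous_onI continuous_intros)
  have cp: "cis t powi (- k) = cis (- (of_int k * t))" for t
    by (simp add: cis_power_int)
  have "(LINT z|circle. 1 * z powi (- k)) = (LINT t|uniform_measure lborel {- pi..pi}. cis t powi (- k))"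
    unfolding circle_def using integral_distr[OF cis_measurable m'[of "- k"]] by simp
  also have "\<dots> = (LINT t|lborel. (indicator {- pi..pi} t / (2 * pi)) *\<^sub>R cis (- (of_int k * t)))"
  proof -
    have "uniform_measure lborel {- pi..pi} = density lborel (\<lambda>t. ennreal (indicator {- pi..pi} t / (2 * pi)))"
      unfolding uniform_measure_def
      by (rule density_cong) (auto simp: indicator_def divide_ennreal ennreal_divide_numeral simp flip: ennreal_1)
    then show ?thesis
      by (simp only: cp) (subst integral_density; (measurable | simp))
  qed
  also have "\<dots> = (1 / (2 * pi)) *\<^sub>R (LINT t|lborel. indicator {- pi..pi} t *\<^sub>R cis (- (of_int k * t)))"
    by (subst integral_scaleR_right[symmetric]) simp
  also have "\<dots> = (if k = 0 then 1 else 0)"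
  proof (cases "k = 0")
    case True
    have "(LINT t|lborel. indicator {- pi..pi} t *\<^sub>R (1 :: complex)) = complex_of_real pi - complex_of_real (- pi)"
      by (rule integral_FTC_Icc) (auto intro!: derivative_eq_intros)
    with True show ?thesis by (simp add: scaleR_conv_of_real)
  next
    case False
    define F where "F t = \<i> / of_int k * cis (- (of_int k * t))" for t :: real
    have "(LINT t|lborel. indicator {- pi..pi} t *\<^sub>R cis (- (of_int k * t))) = F pi - F (- pi)"
    proof (rule integral_FTC_Icc)
      fix t :: real
      show "(F has_vector_derivative cis (- (of_int k * t))) (at t within {- pi..pi})"
        unfolding F_def has_vector_derivative_def using False
        by (auto intro!: derivative_eq_intros simp: fun_eq_iff scaleR_conv_of_real mult.left_commute[of "of_real _" "\<i>"])
    qed (auto intro!: continuous_intros)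
    also have "F pi = F (- pi)"
      by (auto simp: F_def complex_eq_iff sin_zero_iff_int2)
    finally show ?thesis using False by simp
  qed
  finally show "(LINT z|circle. 1 * z powi (- k)) = (if k = 0 then 1 else 0)" .
qed

text \<open>
  Radial boundary values inherit the vanishing of the negative Fourier coefficients of a product
  with a Hardy function: on a circle of radius \<open>r < 1\<close> the factor \<open>F(r z)\<close> is a uniformly convergent
  power series in \<open>z\<close>, and multiplication by \<open>z\<^sup>n\<close> only shifts coefficients upwards; the bound on
  \<open>F\<close> then permits the limit \<open>r \<rightarrow> 1\<close> by dominated convergence.
\<close>
lemma boundary_value_mult_fourier_coeff:
  fixes F t f :: "complex \<Rightarrow> complex"
  assumes F: "F holomorphic_on ball 0 1" "bounded (F ` ball 0 1)"
    and lim: "AE z in circle. ((\<lambda>r. F (complex_of_real r * z)) \<longlongrightarrow> t z) (at_left 1)"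
    and t: "t \<in> borel_measurable circle"
    and f: "square_integrable f" "\<And>k. k < 0 \<Longrightarrow> (LINT z|circle. f z * z powi (- k)) = 0"
    and k: "k < 0"
  shows "(LINT z|circle. t z * f z * z powi (- k)) = 0"
proof -
  have fm [measurable]: "f \<in> borel_measurable circle" using f by (simp add: square_integrable_def)
  note t [measurable]
  have pm [measurable]: "(\<lambda>z. z powi l) \<in> borel_measurable circle" for l :: int
    by (rule borel_measurable_circle) (auto simp: power_int_def)
  have zm [measurable]: "(\<lambda>z. z) \<in> borel_measurable circle"
    by (rule borel_measurable_circle) simp
  have norm_pow: "cmod (z powi l) = 1" if "z \<in> space circle" for z l
    using that by (simp add: space_circle norm_power_int)
  have fi: "integrable circle f"
    using integrable_mult_cnj[OF f(1) square_integrable_bounded[of "\<lambda>_. 1" 1]] by simp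
  have fzi: "integrable circle (\<lambda>z. f z * z powi l)" for l
    by (rule Bochner_Integration.integrable_bound[OF fi]) (auto simp: norm_mult norm_pow intro!: AE_I2)
  define a where "a n = (deriv ^^ n) F 0 / fact n" for n
  have series: "(\<lambda>n. a n * w ^ n) sums F w" if "w \<in> ball 0 1" for w
    using holomorphic_power_series[OF F(1) that] by (simp add: a_def)
  have inside: "(LINT z|circle. F (complex_of_real r * z) * f z * z powi (- k)) = 0"
    and Fm: "(\<lambda>z. F (complex_of_real r * z)) \<in> borel_measurable circle"
    if r: "0 \<le> r" "r < 1" for r
  proof -
    have in_ball: "complex_of_real r * z \<in> ball 0 1" if "z \<in> space circle" for z
      using r that by (simp add: space_circle norm_mult)
    have "continuous_on (sphere 0 1) (\<lambda>z. F (complex_of_real r * z))"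
      using in_ball
      by (intro continuous_on_compose2[OF holomorphic_on_imp_continuous_on[OF F(1)]] continuous_intros)
        (auto simp: space_circle)
    then show Fm: "(\<lambda>z. F (complex_of_real r * z)) \<in> borel_measurable circle"
      using borel_measurable_continuous_on_restrict measurable_cong_sets[OF sets_circle refl] by blast
    note Fm [measurable]
    define C where "C = (\<Sum>n. cmod (a n * complex_of_real r ^ n))"
    \<comment> \<open>convergence at a point of larger modulus gives absolute convergence at radius \<open>r\<close>\<close>
    define r' where "r' = (1 + r) / 2"
    have r': "0 \<le> r'" "r' < 1" "r < r'" using r by (simp_all add: r'_def)
    then have "complex_of_real r' \<in> ball 0 1" by simp
    from powser_insidea[OF sums_summable[OF series[OF this]], of "complex_of_real r"]
    have summable: "summable (\<lambda>n. cmod (a n * complex_of_real r ^ n))"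
      using r r' by simp
    define s where "s N z = (\<Sum>n<N. a n * (complex_of_real r * z) ^ n) * f z * z powi (- k)" for N z
    have summand: "a n * (complex_of_real r * z) ^ n * f z * z powi (- k)
        = (a n * complex_of_real r ^ n) * (f z * z powi (- (k - int n)))" if "z \<in> space circle" for n z
    proof -
      have "z \<noteq> 0" using that by (auto simp: space_circle)
      then have "z powi (- (k - int n)) = z ^ n * z powi (- k)"
        using power_int_add[of z "int n" "- k"] by simp
      then show ?thesis by (simp add: power_mult_distrib mult_ac)
    qed
    have s0: "(LINT z|circle. s N z) = 0" for N
    proof -
      have "(LINT z|circle. s N z)
          = (LINT z|circle. (\<Sum>n<N. (a n * complex_of_real r ^ n) * (f z * z powi (- (k - int n)))))"
        by (rule Bochner_Integration.integral_cong) (simp_all add: s_def sum_distrib_right summand)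
      also have "\<dots> = (\<Sum>n<N. (a n * complex_of_real r ^ n) * (LINT z|circle. f z * z powi (- (k - int n))))"
        using fzi by (subst Bochner_Integration.integral_sum) (auto intro!: integrable_mult_right)
      also have "\<dots> = 0"
        using k f(2) by (intro sum.neutral ballI) (simp del: minus_diff_eq)
      finally show ?thesis .
    qed
    have "(\<lambda>N. LINT z|circle. s N z) \<longlonglongrightarrow> (LINT z|circle. F (complex_of_real r * z) * f z * z powi (- k))"
    proof (rule integral_dominated_convergence)
      show "integrable circle (\<lambda>z. C * cmod (f z))" using fi by simp
      show "AE z in circle. (\<lambda>N. s N z) \<longlonglongrightarrow> F (complex_of_real r * z) * f z * z powi (- k)"
      proof (rule AE_I2)
        fix z assume "z \<in> space circle"
        from series[OF in_ball[OF this]]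
        show "(\<lambda>N. s N z) \<longlonglongrightarrow> F (complex_of_real r * z) * f z * z powi (- k)"
          unfolding s_def sums_def by (intro tendsto_mult tendsto_const)
      qed
      show "AE z in circle. norm (s N z) \<le> C * cmod (f z)" for N
      proof (rule AE_I2)
        fix z assume z: "z \<in> space circle"
        have "cmod (\<Sum>n<N. a n * (complex_of_real r * z) ^ n) \<le> (\<Sum>n<N. cmod (a n * complex_of_real r ^ n))"
          using z by (intro sum_norm_le) (simp add: norm_mult norm_power space_circle power_mult_distrib)
        also have "\<dots> \<le> C"
          unfolding C_def by (rule sum_le_suminf[OF summable]) auto
        finally show "norm (s N z) \<le> C * cmod (f z)"
          using z by (simp add: s_def norm_mult norm_pow mult_right_mono)
      qed
    qed (auto simp: s_def)
    then show "(LINT z|circle. F (complex_of_real r * z) * f z * z powi (- k)) = 0"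
      by (simp add: s0 LIMSEQ_const_iff)
  qed
  obtain B where B: "\<And>w. w \<in> ball 0 1 \<Longrightarrow> cmod (F w) \<le> B"
    using F(2) unfolding bounded_iff by blast
  define r :: "nat \<Rightarrow> real" where "r n = 1 - 1 / real (Suc n)" for n
  have r: "0 \<le> r n" "r n < 1" for n by (simp_all add: r_def)
  have "r \<longlonglongrightarrow> 1 - 0"
    unfolding r_def by (intro tendsto_intros LIMSEQ_Suc[OF lim_1_over_n])
  then have r_lim: "filterlim r (at_left 1) sequentially"
    using r by (auto simp: filterlim_at less_imp_neq intro!: always_eventually)
  have "(\<lambda>n. LINT z|circle. F (complex_of_real (r n) * z) * f z * z powi (- k))
      \<longlonglongrightarrow> (LINT z|circle. t z * f z * z powi (- k))"
  proof (rule integral_dominated_convergence)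
    show "integrable circle (\<lambda>z. B * cmod (f z))" using fi by simp
    show "AE z in circle. (\<lambda>n. F (complex_of_real (r n) * z) * f z * z powi (- k))
        \<longlonglongrightarrow> t z * f z * z powi (- k)"
      using lim
    proof eventually_elim
      case (elim z)
      from filterlim_compose[OF this r_lim] show ?case by (intro tendsto_mult tendsto_const)
    qed
    show "AE z in circle. norm (F (complex_of_real (r n) * z) * f z * z powi (- k)) \<le> B * cmod (f z)" for n
    proof (rule AE_I2)
      fix z assume z: "z \<in> space circle"
      then have "cmod (F (complex_of_real (r n) * z)) \<le> B"
        using r[of n] by (intro B) (simp add: space_circle norm_mult)
      with z show "norm (F (complex_of_real (r n) * z) * f z * z powi (- k)) \<le> B * cmod (f z)"
        by (simp add: norm_mult norm_pow mult_right_mono)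
    qed
    show "(\<lambda>z. F (complex_of_real (r n) * z) * f z * z powi (- k)) \<in> borel_measurable circle" for n
      using Fm[OF r, of n] by measurable
  qed measurable
  then show ?thesis by (simp add: inside[OF r] LIMSEQ_const_iff)
qed

lemma inner_mult_mem_H2:
  assumes "inner_function \<theta>" "h \<in> H2"
  shows "\<theta> * h \<in> H2"
proof -
  have "fourier_coeff (\<theta> * h) k = 0" if "k < 0" for k
    using essentially_bounded_unimodular[OF unimodular_inner_function[OF assms(1)]] assms that
    unfolding H2_def mem_Collect_eq
  proof transfer
    fix \<theta> h :: "complex \<Rightarrow> complex" and k :: int
    assume a: "square_integrable \<theta> \<and> square_integrable \<theta> \<and> (AE z in circle. \<theta> z = \<theta> z)"
      "square_integrable h \<and> square_integrable h \<and> (AE z in circle. h z = h z)"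
      and C: "\<exists>C. AE z in circle. cmod (\<theta> z) \<le> C"
      and i: "(\<exists>F. F holomorphic_on ball 0 1 \<and> bounded (F ` ball 0 1) \<and>
            (AE z in circle. ((\<lambda>r. F (complex_of_real r * z)) \<longlongrightarrow> \<theta> z) (at_left 1))) \<and>
        (AE z in circle. cmod (\<theta> z) = 1)"
      and h: "\<forall>k<0. (LINT z|circle. h z * z powi (- k)) = 0" and k: "k < 0"
    have 1: "square_integrable (\<lambda>z. \<theta> z * h z)"
      using a C square_integrable_mult by blast
    show "(LINT z|circle. (if square_integrable (\<lambda>z. \<theta> z * h z) then \<lambda>z. \<theta> z * h z else (\<lambda>_. 0)) z
        * z powi (- k)) = 0"
      unfolding if_P[OF 1] using i a h k
      by (auto intro!: boundary_value_mult_fourier_coeff[where t = \<theta> and f = h] simp: square_integrable_def)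
  qed
  then show ?thesis by (simp add: H2_def)
qed

lemma H2_eq_ortho: "H2 = ortho (circle_power ` {..<0})"
  by (auto simp: H2_def ortho_def fourier_coeff_eq_cinner)

lemma hardy_proj_mem: "hardy_proj f \<in> H2"
  and hardy_proj_residual: "f - hardy_proj f \<in> ortho H2"
  unfolding hardy_proj_def H2_eq_ortho by (rule ortho_proj_ortho)+

lemma H2_diff: "f \<in> H2 \<Longrightarrow> g \<in> H2 \<Longrightarrow> f - g \<in> H2"
  and H2_scaleC: "f \<in> H2 \<Longrightarrow> c *\<^sub>C f \<in> H2"
  by (simp_all add: H2_def fourier_coeff_linear)

lemma one_mem_H2: "1 \<in> H2"
  by (simp add: H2_def fourier_coeff_one)

lemma zvar_mult_mem_H2: "f \<in> H2 \<Longrightarrow> zvar * f \<in> H2"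
  by (simp add: H2_def fourier_coeff_zvar_mult)

lemma fourier_coeff_0: "fourier_coeff f 0 = cinner f 1"
  by (simp add: fourier_coeff_eq_cinner circle_power_0)

text \<open>
  Pairing with \<open>conj z\<close> gives the coefficient of index \<open>-1\<close>.
\<close>
lemma conj_zvar_ortho_H2: "conj_L2 zvar \<in> ortho H2"
proof -
  have "cinner h (conj_L2 zvar) = 0" if "h \<in> H2" for h
  proof -
    have "cinner h (conj_L2 zvar * 1) = fourier_coeff (zvar * h) 0"
      by (simp add: fourier_coeff_0 cinner_mult_left essentially_bounded_unimodular unimodular_zvar)
    also have "\<dots> = 0" using that by (simp add: fourier_coeff_zvar_mult H2_def)
    finally show ?thesis by (simp add: mult_one_L2)
  qed
  then show ?thesis by (auto simp: ortho_def cinner_commute[of _ "conj_L2 zvar"])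
qed

lemma backward_shift_mem_H2: "f \<in> H2 \<Longrightarrow> conj_L2 zvar * (f - fourier_coeff f 0 *\<^sub>C 1) \<in> H2"
  by (auto simp: H2_def fourier_coeff_conj_zvar_mult fourier_coeff_linear fourier_coeff_one)

section \<open>The decomposition along the model space\<close>

lemma ortho_cinner: "f \<in> ortho S \<Longrightarrow> g \<in> S \<Longrightarrow> cinner f g = 0"
  and ortho_cinner': "f \<in> ortho S \<Longrightarrow> g \<in> S \<Longrightarrow> cinner g f = 0"
  by (auto simp: ortho_def cinner_commute[of g f])

lemmas zvar_bounded = essentially_bounded_unimodular[OF unimodular_zvar]
  and conj_zvar_bounded = essentially_bounded_unimodular[OF unimodular_conj[OF unimodular_zvar]]
  and zvar_cancel = conj_mult_cancel[OF unimodular_zvar] mult_conj_cancel[OF unimodular_zvar]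

context
  fixes \<theta> :: L2
  assumes \<theta>: "inner_function \<theta>"
begin

lemmas bounded = essentially_bounded_unimodular[OF unimodular_inner_function[OF \<theta>]]
  and conj_bounded = essentially_bounded_unimodular[OF unimodular_conj[OF unimodular_inner_function[OF \<theta>]]]
  and cancel = conj_mult_cancel[OF unimodular_inner_function[OF \<theta>]]
    mult_conj_cancel[OF unimodular_inner_function[OF \<theta>]]

lemma model_spaceI: "k \<in> H2 \<Longrightarrow> (\<And>h. h \<in> H2 \<Longrightarrow> cinner k (\<theta> * h) = 0) \<Longrightarrow> k \<in> model_space \<theta>"
  by (auto simp: model_space_def ortho_def)

lemma model_spaceD:
  assumes "k \<in> model_space \<theta>"
  shows "k \<in> H2" "h \<in> H2 \<Longrightarrow> cinner k (\<theta> * h) = 0"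
  using assms by (auto simp: model_space_def ortho_def)

lemma model_space_diff: "f \<in> model_space \<theta> \<Longrightarrow> g \<in> model_space \<theta> \<Longrightarrow> f - g \<in> model_space \<theta>"
  and model_space_scaleC: "f \<in> model_space \<theta> \<Longrightarrow> c *\<^sub>C f \<in> model_space \<theta>"
  by (auto simp: model_space_def intro: H2_diff H2_scaleC ortho_diff ortho_scaleC)

lemma mult_theta_mem_perp: "h \<in> H2 \<Longrightarrow> \<theta> * h \<in> model_space_perp \<theta>"
  by (auto simp: model_space_perp_def ortho_def cinner_commute[of "\<theta> * h"] model_spaceD)

lemma theta_mem_perp: "\<theta> \<in> model_space_perp \<theta>"
  using mult_theta_mem_perp[OF one_mem_H2] by (simp add: mult_one_L2)

lemma theta_mem_H2: "\<theta> \<in> H2"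
  using inner_mult_mem_H2[OF \<theta> one_mem_H2] by (simp add: mult_one_L2)

lemma ortho_H2_subset_perp: "f \<in> ortho H2 \<Longrightarrow> f \<in> model_space_perp \<theta>"
  by (auto simp: model_space_perp_def ortho_def model_spaceD)

lemma proj_perp_mem: "proj_perp \<theta> f \<in> model_space_perp \<theta>"
  using ortho_H2_subset_perp[OF hardy_proj_residual] mult_theta_mem_perp[OF hardy_proj_mem]
  by (auto simp: proj_perp_def hardy_coproj_def model_space_perp_def intro!: ortho_add)

text \<open>
  The residual is \<open>P f - \<theta> P (conj \<theta> f)\<close>, which is analytic because \<open>\<theta>\<close> preserves \<open>H\<^sup>2\<close>. Against
  \<open>\<theta> h\<close> its two terms cancel: both equal \<open>\<langle>f, \<theta> h\<rangle>\<close>, as \<open>\<theta>\<close> acts isometrically.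
\<close>
lemma proj_perp_residual: "f - proj_perp \<theta> f \<in> model_space \<theta>"
proof -
  define g where "g = conj_L2 \<theta> * f"
  have eq: "f - proj_perp \<theta> f = hardy_proj f - \<theta> * hardy_proj g"
    by (simp add: proj_perp_def hardy_coproj_def g_def)
  show ?thesis
    unfolding eq
  proof (rule model_spaceI)
    show "hardy_proj f - \<theta> * hardy_proj g \<in> H2"
      by (intro H2_diff inner_mult_mem_H2[OF \<theta>] hardy_proj_mem)
    fix h assume h: "h \<in> H2"
    have "cinner (f - hardy_proj f) (\<theta> * h) = 0" "cinner (g - hardy_proj g) h = 0"
      using h inner_mult_mem_H2[OF \<theta>] hardy_proj_residual by (auto intro: ortho_cinner)
    moreover have "cinner (\<theta> * hardy_proj g) (\<theta> * h) = cinner (hardy_proj g) h"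
      by (simp add: cinner_mult_left[OF bounded] cancel)
    moreover have "cinner g h = cinner f (\<theta> * h)"
      by (simp add: g_def cinner_mult_left[OF conj_bounded])
    ultimately show "cinner (hardy_proj f - \<theta> * hardy_proj g) (\<theta> * h) = 0"
      by (simp add: cinner_linear)
  qed
qed

text \<open>
  The model space and its complement meet only in 0. All later values of the projection are
  obtained by guessing the decomposition and appealing to this fact.
\<close>
lemma proj_perp_unique:
  assumes "a \<in> model_space_perp \<theta>" "f - a \<in> model_space \<theta>"
  shows "proj_perp \<theta> f = a"
proof -
  have "proj_perp \<theta> f - a \<in> model_space_perp \<theta>"
    using proj_perp_mem assms(1) unfolding model_space_perp_def by (rule ortho_diff)
  moreover have "(f - a) - (f - proj_perp \<theta> f) \<in> model_space \<theta>"
    using assms(2) proj_perp_residual by (rule model_space_diff)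
  ultimately show ?thesis
    using ortho_inter_self[of "proj_perp \<theta> f - a" "model_space \<theta>"]
    by (simp add: model_space_perp_def)
qed

lemma proj_perp_diff: "proj_perp \<theta> (f - g) = proj_perp \<theta> f - proj_perp \<theta> g"
proof (rule proj_perp_unique)
  show "proj_perp \<theta> f - proj_perp \<theta> g \<in> model_space_perp \<theta>"
    using proj_perp_mem unfolding model_space_perp_def by (blast intro: ortho_diff)
  have "(f - proj_perp \<theta> f) - (g - proj_perp \<theta> g) \<in> model_space \<theta>"
    by (intro model_space_diff proj_perp_residual)
  then show "f - g - (proj_perp \<theta> f - proj_perp \<theta> g) \<in> model_space \<theta>"
    by (simp add: algebra_simps)
qed

lemma proj_perp_scaleC: "proj_perp \<theta> (c *\<^sub>C f) = c *\<^sub>C proj_perp \<theta> f"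
proof (rule proj_perp_unique)
  show "c *\<^sub>C proj_perp \<theta> f \<in> model_space_perp \<theta>"
    using proj_perp_mem unfolding model_space_perp_def by (blast intro: ortho_scaleC)
  have "c *\<^sub>C (f - proj_perp \<theta> f) \<in> model_space \<theta>"
    by (intro model_space_scaleC proj_perp_residual)
  then show "c *\<^sub>C f - c *\<^sub>C proj_perp \<theta> f \<in> model_space \<theta>"
    by (simp add: scaleC_diff_right)
qed

lemma cinner_proj_perp:
  assumes "a \<in> model_space_perp \<theta>"
  shows "cinner (proj_perp \<theta> f) a = cinner f a" "cinner a (proj_perp \<theta> f) = cinner a f"
proof -
  show "cinner (proj_perp \<theta> f) a = cinner f a"
    using ortho_cinner'[OF assms[unfolded model_space_perp_def] proj_perp_residual[of f]]
    by (simp add: cinner_linear)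
  then show "cinner a (proj_perp \<theta> f) = cinner a f"
    by (metis cinner_commute)
qed

section \<open>The adjoint of the compressed shift\<close>

text \<open>
  The projection is self-adjoint and the adjoint of multiplication by \<open>z\<close> is multiplication by its
  conjugate.
\<close>
lemma compressed_shift_adj_eq:
  assumes g: "g \<in> model_space_perp \<theta>"
  shows "compressed_shift_adj \<theta> g = proj_perp \<theta> (conj_L2 zvar * g)"
  unfolding compressed_shift_adj_def adjoint_on_def
proof (rule the_equality)
  let ?S = "model_space_perp \<theta>" and ?a = "proj_perp \<theta> (conj_L2 zvar * g)"
  have adj: "cinner (compressed_shift \<theta> f) g = cinner f ?a" if "f \<in> ?S" for f
    using that g by (simp add: compressed_shift_def cinner_proj_perp cinner_mult_left[OF zvar_bounded])
  then show "?a \<in> ?S \<and> (\<forall>f\<in>?S. cinner (compressed_shift \<theta> f) g = cinner f ?a)"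
    by (simp add: proj_perp_mem)
  fix k assume k: "k \<in> ?S \<and> (\<forall>f\<in>?S. cinner (compressed_shift \<theta> f) g = cinner f k)"
  then have "k - ?a \<in> ?S"
    using proj_perp_mem unfolding model_space_perp_def by (blast intro: ortho_diff)
  with k adj have "cinner (k - ?a) (k - ?a) = 0"
    using cinner_diff_right[of "k - ?a" k ?a] by simp
  then show "k = ?a" by (simp add: cinner_self_eq_zero)
qed

abbreviation (input) \<theta>0 where "\<theta>0 \<equiv> fourier_coeff \<theta> 0"

lemma backward_shift_theta_mem: "conj_L2 zvar * (\<theta> - \<theta>0 *\<^sub>C 1) \<in> model_space \<theta>"
proof (rule model_spaceI)
  show "conj_L2 zvar * (\<theta> - \<theta>0 *\<^sub>C 1) \<in> H2"
    by (rule backward_shift_mem_H2[OF theta_mem_H2])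
  fix h assume h: "h \<in> H2"
  have "cinner (conj_L2 zvar * \<theta>) (\<theta> * h) = cinner (conj_L2 zvar) h"
    by (subst L2_mult_commute) (simp add: cinner_mult_left[OF bounded] cancel)
  also have "\<dots> = 0" using conj_zvar_ortho_H2 h by (rule ortho_cinner)
  finally have 1: "cinner (conj_L2 zvar * \<theta>) (\<theta> * h) = 0" .
  have "\<theta> * h \<in> H2" using h by (rule inner_mult_mem_H2[OF \<theta>])
  then have "cinner (conj_L2 zvar) (\<theta> * h) = 0" by (rule ortho_cinner[OF conj_zvar_ortho_H2])
  with 1 show "cinner (conj_L2 zvar * (\<theta> - \<theta>0 *\<^sub>C 1)) (\<theta> * h) = 0"
    by (simp add: mult_diff_L2[OF conj_zvar_bounded] mult_scaleC_L2[OF conj_zvar_bounded] mult_one_L2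
        cinner_linear)
qed

text \<open>
  Multiplication by \<open>z\<close> leaves the model space only in the direction \<open>\<theta>\<close>. Write \<open>h \<in> H\<^sup>2\<close> as
  \<open>z h\<^sub>1 + h\<^sub>0\<close>. Then \<open>\<langle>z k, \<theta> z h\<^sub>1\<rangle> = \<langle>k, \<theta> h\<^sub>1\<rangle> = 0\<close>, so \<open>z k\<close> pairs with \<open>\<theta> h\<close> only through the
  constant term \<open>h\<^sub>0\<close>, and so does \<open>\<theta>\<close> itself.
\<close>
lemma zvar_mult_model_space:
  assumes k: "k \<in> model_space \<theta>"
  shows "zvar * k - cinner (zvar * k) \<theta> *\<^sub>C \<theta> \<in> model_space \<theta>"
proof (rule model_spaceI)
  let ?c = "cinner (zvar * k) \<theta>"
  show "zvar * k - ?c *\<^sub>C \<theta> \<in> H2"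
    by (intro H2_diff H2_scaleC zvar_mult_mem_H2 theta_mem_H2 model_spaceD(1)[OF k])
  fix h assume h: "h \<in> H2"
  define h1 where "h1 = conj_L2 zvar * (h - fourier_coeff h 0 *\<^sub>C 1)"
  have h1: "h1 \<in> H2" unfolding h1_def using h by (rule backward_shift_mem_H2)
  have "zvar * h1 = h - fourier_coeff h 0 *\<^sub>C 1" by (simp add: h1_def zvar_cancel)
  then have h_eq: "h = zvar * h1 + fourier_coeff h 0 *\<^sub>C 1" by simp
  have "cinner (zvar * k) (\<theta> * (zvar * h1)) = cinner k (\<theta> * h1)"
    by (simp add: cinner_mult_left[OF zvar_bounded] mult_left_commute_L2[OF bounded zvar_bounded] zvar_cancel)
  also have "\<dots> = 0" using k h1 by (rule model_spaceD(2))
  finally have "cinner (zvar * k) (\<theta> * (zvar * h1)) = 0" .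
  then have "cinner (zvar * k) (\<theta> * h) = cnj (fourier_coeff h 0) * ?c"
    by (subst h_eq) (simp add: mult_add_L2[OF bounded] mult_scaleC_L2[OF bounded] mult_one_L2 cinner_linear)
  moreover have "cinner \<theta> (\<theta> * h) = cnj (fourier_coeff h 0)"
  proof -
    have "cinner \<theta> (\<theta> * h) = cinner (\<theta> * 1) (\<theta> * h)" by (simp add: mult_one_L2)
    also have "\<dots> = cinner 1 h" by (simp only: cinner_mult_left[OF bounded] cancel)
    finally show ?thesis by (simp add: fourier_coeff_0 cinner_commute[of 1 h])
  qed
  ultimately show "cinner (zvar * k - ?c *\<^sub>C \<theta>) (\<theta> * h) = 0"
    by (simp add: cinner_linear)
qed

text \<open>
  The dual form of the preceding lemma: for \<open>k\<close> in the model space it says that \<open>\<langle>conj z h, k\<rangle>\<close> is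
  \<open>\<langle>h, \<theta>\<rangle> \<langle>\<theta>, z k\<rangle>\<close>, so the model-space component of \<open>conj z h\<close> is a multiple of one fixed vector.
  This is the origin of the rank-one operator whose second factor is \<open>\<theta>\<close>.
\<close>
lemma compressed_shift_adj_formula:
  assumes h: "h \<in> model_space_perp \<theta>"
  shows "compressed_shift_adj \<theta> h
    = conj_L2 zvar * h - cinner h \<theta> *\<^sub>C (conj_L2 zvar * (\<theta> - \<theta>0 *\<^sub>C 1))"
  unfolding compressed_shift_adj_eq[OF h]
proof (rule proj_perp_unique)
  let ?e = "conj_L2 zvar * (\<theta> - \<theta>0 *\<^sub>C 1)"
  have "cinner (conj_L2 zvar * h - cinner h \<theta> *\<^sub>C ?e) k = 0" if k: "k \<in> model_space \<theta>" for k
  proof -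
    let ?c = "cinner (zvar * k) \<theta>"
    have 1: "cinner (conj_L2 zvar * h) k = cinner h (zvar * k)"
      by (simp add: cinner_mult_left[OF conj_zvar_bounded])
    have "cinner h (zvar * k - ?c *\<^sub>C \<theta>) = 0"
      using ortho_cinner[OF h[unfolded model_space_perp_def] zvar_mult_model_space[OF k]] .
    then have 2: "cinner h (zvar * k) = cnj ?c * cinner h \<theta>"
      by (simp add: cinner_linear)
    have "cinner (conj_L2 zvar) k = 0"
      using conj_zvar_ortho_H2 model_spaceD(1)[OF k] by (rule ortho_cinner)
    then have 3: "cinner ?e k = cnj ?c"
      by (simp add: mult_diff_L2[OF conj_zvar_bounded] mult_scaleC_L2[OF conj_zvar_bounded]
          mult_one_L2 cinner_linear cinner_mult_left[OF conj_zvar_bounded] cinner_commute[of \<theta>])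
    show ?thesis by (simp add: cinner_linear 1 2 3)
  qed
  then show "conj_L2 zvar * h - cinner h \<theta> *\<^sub>C ?e \<in> model_space_perp \<theta>"
    by (simp add: model_space_perp_def ortho_def)
  show "conj_L2 zvar * h - (conj_L2 zvar * h - cinner h \<theta> *\<^sub>C ?e) \<in> model_space \<theta>"
    using model_space_scaleC[OF backward_shift_theta_mem] by simp
qed

text \<open>The reproducing kernel of the model space at the origin.\<close>
definition kernel_0 :: L2 where "kernel_0 = 1 - cnj \<theta>0 *\<^sub>C \<theta>"

lemma kernel_0_reproduces:
  assumes k: "k \<in> model_space \<theta>"
  shows "cinner k kernel_0 = fourier_coeff k 0"
  using model_spaceD(2)[OF k one_mem_H2]
  by (simp add: kernel_0_def cinner_linear mult_one_L2 fourier_coeff_0)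

text \<open>
  Taking constant terms is multiplicative on analytic functions, so \<open>\<langle>1, \<theta> h\<rangle>\<close> is
  \<open>cnj \<theta>\<^sub>0 \<langle>1, h\<rangle>\<close>; and \<open>\<langle>\<theta>, \<theta> h\<rangle> = \<langle>1, h\<rangle>\<close> because \<open>\<theta>\<close> is unimodular.
\<close>
lemma kernel_0_mem: "kernel_0 \<in> model_space \<theta>"
proof (rule model_spaceI)
  show "kernel_0 \<in> H2"
    unfolding kernel_0_def by (intro H2_diff H2_scaleC one_mem_H2 theta_mem_H2)
  fix h assume h: "h \<in> H2"
  have mean: "cinner 1 (\<theta> * h) = cnj \<theta>0 * cinner 1 h"
  proof -
    define h1 where "h1 = conj_L2 zvar * (h - fourier_coeff h 0 *\<^sub>C 1)"
    have "zvar * h1 = h - fourier_coeff h 0 *\<^sub>C 1" by (simp add: h1_def zvar_cancel)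
    then have h_eq: "h = zvar * h1 + fourier_coeff h 0 *\<^sub>C 1" by simp
    have "\<theta> * h1 \<in> H2"
      unfolding h1_def by (intro inner_mult_mem_H2[OF \<theta>] backward_shift_mem_H2 h)
    then have "fourier_coeff (zvar * (\<theta> * h1)) 0 = 0"
      by (simp add: fourier_coeff_zvar_mult H2_def)
    then have "fourier_coeff (\<theta> * h) 0 = fourier_coeff h 0 * \<theta>0"
      by (subst h_eq) (simp add: mult_add_L2[OF bounded] mult_scaleC_L2[OF bounded] mult_one_L2
        mult_left_commute_L2[OF bounded zvar_bounded] fourier_coeff_linear)
    then show ?thesis
      by (simp add: fourier_coeff_0 cinner_commute[of 1])
  qed
  have "cinner \<theta> (\<theta> * h) = cinner (\<theta> * 1) (\<theta> * h)" by (simp add: mult_one_L2)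
  also have "\<dots> = cinner 1 h" by (simp only: cinner_mult_left[OF bounded] cancel)
  finally show "cinner kernel_0 (\<theta> * h) = 0"
    by (simp add: kernel_0_def cinner_linear mean)
qed

text \<open>
  The shift and the backward shift fail to cancel because \<open>z f\<close> loses its model-space component
  \<open>k\<close>; of \<open>conj z k\<close> only the term \<open>k\<^sub>0 conj z\<close> survives the projection, and \<open>k\<^sub>0\<close> is read off by the
  reproducing kernel.
\<close>
lemma compressed_shift_adj_proj_zvar:
  "compressed_shift_adj \<theta> (proj_perp \<theta> (zvar * f))
    = proj_perp \<theta> f - cinner (zvar * f) kernel_0 *\<^sub>C conj_L2 zvar"
proof -
  define k where "k = zvar * f - proj_perp \<theta> (zvar * f)"
  have k: "k \<in> model_space \<theta>" unfolding k_def by (rule proj_perp_residual)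
  have "cinner (proj_perp \<theta> (zvar * f)) kernel_0 = 0"
    using proj_perp_mem kernel_0_mem unfolding model_space_perp_def by (rule ortho_cinner)
  then have "cinner (zvar * f) kernel_0 = cinner k kernel_0"
    by (simp add: k_def cinner_linear)
  then have k0: "cinner (zvar * f) kernel_0 = fourier_coeff k 0"
    by (simp add: kernel_0_reproduces[OF k])
  have "proj_perp \<theta> (conj_L2 zvar * k) = fourier_coeff k 0 *\<^sub>C conj_L2 zvar"
  proof (rule proj_perp_unique)
    show "fourier_coeff k 0 *\<^sub>C conj_L2 zvar \<in> model_space_perp \<theta>"
      by (intro ortho_H2_subset_perp ortho_scaleC conj_zvar_ortho_H2)
    have eq: "conj_L2 zvar * k - fourier_coeff k 0 *\<^sub>C conj_L2 zvar
        = conj_L2 zvar * (k - fourier_coeff k 0 *\<^sub>C 1)"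
      by (simp add: mult_diff_L2[OF conj_zvar_bounded] mult_scaleC_L2[OF conj_zvar_bounded] mult_one_L2)
    show "conj_L2 zvar * k - fourier_coeff k 0 *\<^sub>C conj_L2 zvar \<in> model_space \<theta>"
    proof (rule model_spaceI)
      show "conj_L2 zvar * k - fourier_coeff k 0 *\<^sub>C conj_L2 zvar \<in> H2"
        unfolding eq using model_spaceD(1)[OF k] by (rule backward_shift_mem_H2)
      fix h assume h: "h \<in> H2"
      have "cinner (conj_L2 zvar * k) (\<theta> * h) = cinner k (\<theta> * (zvar * h))"
        by (simp add: cinner_mult_left[OF conj_zvar_bounded] mult_left_commute_L2[OF bounded zvar_bounded])
      also have "\<dots> = 0" using k zvar_mult_mem_H2[OF h] by (rule model_spaceD(2))
      finally have "cinner (conj_L2 zvar * k) (\<theta> * h) = 0" .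
      moreover have "cinner (conj_L2 zvar) (\<theta> * h) = 0"
        using conj_zvar_ortho_H2 inner_mult_mem_H2[OF \<theta> h] by (rule ortho_cinner)
      ultimately show "cinner (conj_L2 zvar * k - fourier_coeff k 0 *\<^sub>C conj_L2 zvar) (\<theta> * h) = 0"
        by (simp add: cinner_linear)
    qed
  qed
  moreover have "conj_L2 zvar * proj_perp \<theta> (zvar * f) = f - conj_L2 zvar * k"
    by (simp add: k_def mult_diff_L2[OF conj_zvar_bounded] zvar_cancel)
  ultimately show ?thesis
    by (simp add: compressed_shift_adj_eq[OF proj_perp_mem] proj_perp_diff k0)
qed

section \<open>The displacement formula\<close>

context
  fixes \<phi> :: L2
  assumes \<phi>: "essentially_bounded \<phi>"
begin

lemma flip_mult_conj_zvar: "flip (\<phi> * (conj_L2 zvar * f)) = zvar * flip (\<phi> * f)"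
proof -
  have "flip (conj_L2 zvar) = zvar" using flip_flip[of zvar] by (simp add: flip_zvar)
  then show ?thesis
    by (simp add: mult_left_commute_L2[OF \<phi> conj_zvar_bounded] flip_mult[OF conj_zvar_bounded])
qed

text \<open>
  The function \<open>\<beta>\<close> is the kernel at the origin transported through the adjoints of \<open>z\<close>, of \<open>J\<close> and of
  multiplication by \<open>\<phi>\<close>, and then projected, since it is only tested against the complement of
  the model space.
\<close>
lemma cinner_flip_kernel_0:
  assumes h: "h \<in> model_space_perp \<theta>"
  shows "cinner (zvar * flip (\<phi> * h)) kernel_0 = cinner h (beta_fn \<theta> \<phi>)"
proof -
  have "cinner (zvar * flip (\<phi> * h)) kernel_0 = cinner (flip (\<phi> * (conj_L2 zvar * h))) kernel_0"
    by (simp add: flip_mult_conj_zvar)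
  also have "\<dots> = cinner h (zvar * (conj_L2 \<phi> * flip kernel_0))"
    by (simp add: cinner_flip cinner_mult_left[OF \<phi>] cinner_mult_left[OF conj_zvar_bounded])
  also have "\<dots> = cinner h (beta_fn \<theta> \<phi>)"
    by (simp add: beta_fn_def kernel_0_def cinner_proj_perp[OF h] flip_diff flip_scaleC flip_one
        mult_left_commute_L2[OF zvar_bounded essentially_bounded_conj[OF \<phi>]])
  finally show ?thesis .
qed

text \<open>
  As \<open>\<eta> = \<phi> \<theta> - \<theta>\<^sub>0 \<phi>\<close>, and \<open>\<theta>\<close> itself lies in the complement of the model space, the pairing with
  \<open>\<phi> \<theta>\<close> is \<open>\<langle>\<theta>, \<beta>\<rangle>\<close>; what \<open>\<theta>\<^sub>0 \<phi>\<close> contributes is the constant.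
\<close>
lemma delta_const_eq:
  "delta_const \<theta> \<phi> = cinner \<theta> (beta_fn \<theta> \<phi>) - cinner (zvar * flip (eta_fn \<theta> \<phi>)) kernel_0"
proof -
  let ?g = "flip (\<phi> * conj_L2 zvar)"
  have zflip: "zvar * flip \<phi> = ?g"
    using flip_mult_conj_zvar[of 1] by (simp add: mult_one_L2)
  have "zvar * flip (\<phi> * \<theta>) - zvar * flip (eta_fn \<theta> \<phi>) = \<theta>0 *\<^sub>C ?g"
    by (simp add: eta_fn_def mult_diff_L2[OF \<phi>] mult_scaleC_L2[OF \<phi>] mult_one_L2 flip_diff flip_scaleC
        mult_diff_L2[OF zvar_bounded] mult_scaleC_L2[OF zvar_bounded] zflip)
  then have "cinner \<theta> (beta_fn \<theta> \<phi>) - cinner (zvar * flip (eta_fn \<theta> \<phi>)) kernel_0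
      = \<theta>0 * cinner ?g kernel_0"
    unfolding cinner_flip_kernel_0[OF theta_mem_perp, symmetric]
    by (simp flip: cinner_diff_left add: cinner_scaleC_left)
  also have "cinner ?g kernel_0 = fourier_coeff ?g 0 - \<theta>0 * fourier_coeff (conj_L2 \<theta> * ?g) 0"
    by (simp add: kernel_0_def cinner_linear fourier_coeff_0 cinner_mult_left[OF conj_bounded] mult_one_L2)
  finally show ?thesis by (simp add: delta_const_def)
qed

text \<open>
  Both defects of the shift combined, with the coefficients of \<open>conj z\<close> still expressed by the
  kernel at the origin.
\<close>
lemma dual_trunc_hankel_displacement:
  assumes h: "h \<in> model_space_perp \<theta>"
  shows "dual_trunc_hankel \<theta> \<phi> h
       - compressed_shift_adj \<theta> (dual_trunc_hankel \<theta> \<phi> (compressed_shift_adj \<theta> h))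
     = cinner h (beta_fn \<theta> \<phi>) *\<^sub>C conj_L2 zvar
       + cinner h \<theta> *\<^sub>C proj_perp \<theta> (flip (eta_fn \<theta> \<phi>))
       - (cinner h \<theta> * cinner (zvar * flip (eta_fn \<theta> \<phi>)) kernel_0) *\<^sub>C conj_L2 zvar"
proof -
  let ?\<eta> = "flip (eta_fn \<theta> \<phi>)" and ?c = "cinner h \<theta>"
  define f where "f = flip (\<phi> * h) - ?c *\<^sub>C ?\<eta>"
  have "\<phi> * compressed_shift_adj \<theta> h
      = \<phi> * (conj_L2 zvar * h) - ?c *\<^sub>C (\<phi> * (conj_L2 zvar * (\<theta> - \<theta>0 *\<^sub>C 1)))"
    by (simp only: compressed_shift_adj_formula[OF h] mult_diff_L2[OF \<phi>] mult_scaleC_L2[OF \<phi>])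
  then have "flip (\<phi> * compressed_shift_adj \<theta> h) = zvar * flip (\<phi> * h) - ?c *\<^sub>C (zvar * ?\<eta>)"
    by (simp only: flip_diff flip_scaleC flip_mult_conj_zvar eta_fn_def)
  also have "\<dots> = zvar * f"
    by (simp add: f_def mult_diff_L2[OF zvar_bounded] mult_scaleC_L2[OF zvar_bounded])
  finally have "flip (\<phi> * compressed_shift_adj \<theta> h) = zvar * f" .
  then have "compressed_shift_adj \<theta> (dual_trunc_hankel \<theta> \<phi> (compressed_shift_adj \<theta> h))
      = proj_perp \<theta> f - cinner (zvar * f) kernel_0 *\<^sub>C conj_L2 zvar"
    by (simp add: dual_trunc_hankel_def compressed_shift_adj_proj_zvar)
  moreover have "proj_perp \<theta> f = dual_trunc_hankel \<theta> \<phi> h - ?c *\<^sub>C proj_perp \<theta> ?\<eta>"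
    by (simp add: f_def proj_perp_diff proj_perp_scaleC dual_trunc_hankel_def)
  moreover have "cinner (zvar * f) kernel_0
      = cinner h (beta_fn \<theta> \<phi>) - ?c * cinner (zvar * ?\<eta>) kernel_0"
    by (simp add: f_def mult_diff_L2[OF zvar_bounded] mult_scaleC_L2[OF zvar_bounded] cinner_linear
        cinner_flip_kernel_0[OF h])
  ultimately show ?thesis
    by (simp add: scaleC_diff_left)
qed

end

end

theorem theorem2p4:
  fixes \<theta> \<phi> :: L2
  assumes "inner_function \<theta>"
    and "essentially_bounded \<phi>"
  shows "\<forall>h \<in> model_space_perp \<theta>.
     dual_trunc_hankel \<theta> \<phi> h
       - compressed_shift_adj \<theta> (dual_trunc_hankel \<theta> \<phi> (compressed_shift_adj \<theta> h))
     = (conj_L2 zvar \<otimes>\<^sub>L (beta_fn \<theta> \<phi> - cinner (beta_fn \<theta> \<phi>) \<theta> *\<^sub>C \<theta>)) h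
       + ((proj_perp \<theta> (flip (eta_fn \<theta> \<phi>)) + delta_const \<theta> \<phi> *\<^sub>C conj_L2 zvar) \<otimes>\<^sub>L \<theta>) h"
proof
  fix h assume h: "h \<in> model_space_perp \<theta>"
  let ?c = "cinner h \<theta>" and ?n = "cinner (zvar * flip (eta_fn \<theta> \<phi>)) (kernel_0 \<theta>)"
  have first: "(conj_L2 zvar \<otimes>\<^sub>L (beta_fn \<theta> \<phi> - cinner (beta_fn \<theta> \<phi>) \<theta> *\<^sub>C \<theta>)) h
      = cinner h (beta_fn \<theta> \<phi>) *\<^sub>C conj_L2 zvar - (cinner \<theta> (beta_fn \<theta> \<phi>) * ?c) *\<^sub>C conj_L2 zvar"
    by (simp add: rank_one_def cinner_linear scaleC_diff_left cinner_commute[of \<theta> "beta_fn \<theta> \<phi>"])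
  have second: "((proj_perp \<theta> (flip (eta_fn \<theta> \<phi>)) + delta_const \<theta> \<phi> *\<^sub>C conj_L2 zvar) \<otimes>\<^sub>L \<theta>) h
      = ?c *\<^sub>C proj_perp \<theta> (flip (eta_fn \<theta> \<phi>))
        + ((cinner \<theta> (beta_fn \<theta> \<phi>) * ?c) *\<^sub>C conj_L2 zvar - (?c * ?n) *\<^sub>C conj_L2 zvar)"
    by (simp add: rank_one_def scaleC_add_right scaleC_scaleC delta_const_eq[OF assms]
        scaleC_diff_left scaleC_diff_right mult.commute)
  show "dual_trunc_hankel \<theta> \<phi> h
       - compressed_shift_adj \<theta> (dual_trunc_hankel \<theta> \<phi> (compressed_shift_adj \<theta> h))
     = (conj_L2 zvar \<otimes>\<^sub>L (beta_fn \<theta> \<phi> - cinner (beta_fn \<theta> \<phi>) \<theta> *\<^sub>C \<theta>)) h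
       + ((proj_perp \<theta> (flip (eta_fn \<theta> \<phi>)) + delta_const \<theta> \<phi> *\<^sub>C conj_L2 zvar) \<otimes>\<^sub>L \<theta>) h"
    unfolding dual_trunc_hankel_displacement[OF assms h] first second by simp
qed

end
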